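(* Let $d\ge2$ and let $M\subseteq\mathbb{C}^d$ be an increasing union of bounded domains in $\mathbb{C}^d$ with a common positive squeezing constant; that is, $M=\bigcup_{n=1}^\infty M_n$ where each $M_n\subset\mathbb{C}^d$ is a bounded domain, $M_n\subset\subset M_{n+1}$ for all $n$, and there is $r>0$ with $S_{M_n}(z)\ge r$ for all $n\ge1$ and all $z\in M_n$. Then the dimension of the Bergman space $$L^2(M)=\Big\{f:M\to\mathbb{C}\text{ holomorphic}: \int_M|f|^2<\infty\Big\}$$ is either zero or infinity. Further, if the corank of the infinitesimal Kobayashi metric of $M$ is strictly greater than zero, then the Euclidean volume of $M$ is infinite.
   Context: For $\rho>0$, $B(0;\rho)=\{z\in\mathbb{C}^d:\|z\|<\rho\}$. For a bounded domain $\Omega\subset\mathbb{C}^d$ and $p\in\Omega$, the squeezing function is $S_\Omega(p)=\sup_f\sup\{\rho>0:B(0;\rho)\subseteq f(\Omega)\}$, the outer supremum being over all holomorphic embeddings $f:\Omega\to B(0;1)$ with $f(p)=0$. The integral is with respect to Lebesgue measure on $\mathbb{C}^d$. The infinitesimal Kobayashi metric of $M$ is $K_M(p;\xi)=\inf\{s>0:\text{ there is a holomorphic }\rho:\Delta\to M\text{ with }\rho(0)=p,\ \rho'(0)=\xi/s\}$, $\Delta$ the unit disc in $\mathbb{C}$. The Kobayashi corank of $M$ at $p$ is $k_p=\dim_{\mathbb{C}}\{\xi: K_M(p;\xi)=0\}$; for $M$ as in the claim this set is a vector space for every $p$ and $k_p$ does not depend on $p\in M$, and this constant is the corank of the infinitesimal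 Kobayashi metric of $M$. *)

theory Defs
  imports "HOL-Complex_Analysis.Complex_Analysis" "HOL-Library.Function_Algebras" "HOL-Library.Extended_Nat"
begin

definition bounded_domain :: "(complex ^ 'n) set \<Rightarrow> bool" where
  "bounded_domain U \<longleftrightarrow> open U \<and> connected U \<and> U \<noteq> {} \<and> bounded U"

definition relatively_compact_in :: "(complex ^ 'n) set \<Rightarrow> (complex ^ 'n) set \<Rightarrow> bool" where
  "relatively_compact_in U V \<longleftrightarrow> compact (closure U) \<and> closure U \<subseteq> V"

text \<open>Holomorphy in several variables is complex Frechet differentiability:
  the real derivative exists and is complex linear. All sets in use are open.\<close>

definition holomorphic_fun_on :: "(complex ^ 'n \<Rightarrow> complex) \<Rightarrow> (complex ^ 'n) set \<Rightarrow> bool" where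
  "holomorphic_fun_on f U \<longleftrightarrow>
     (\<forall>z\<in>U. \<exists>L. Vector_Spaces.linear (*s) (*) L \<and> (f has_derivative L) (at z within U))"

text \<open>An embedding is an injective immersion that is a homeomorphism onto its image.\<close>

definition holomorphic_embedding_on ::
    "(complex ^ 'n \<Rightarrow> complex ^ 'm) \<Rightarrow> (complex ^ 'n) set \<Rightarrow> bool" where
  "holomorphic_embedding_on f U \<longleftrightarrow>
     (\<forall>z\<in>U. \<exists>L. Vector_Spaces.linear (*s) (*s) L \<and> inj L \<and> (f has_derivative L) (at z within U)) \<and>
     (\<exists>g. homeomorphism U (f ` U) f g)"

text \<open>For a bounded domain and a point of it, both suprema below are over nonempty subsets
  of the interval from 0 to 1, so they are genuine real suprema.\<close>

definition squeezing_function :: "(complex ^ 'n) set \<Rightarrow> complex ^ 'n \<Rightarrow> real" where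
  "squeezing_function U p =
     (SUP f \<in> {f :: complex ^ 'n \<Rightarrow> complex ^ 'n.
                 holomorphic_embedding_on f U \<and> f ` U \<subseteq> ball 0 1 \<and> f p = 0}.
        Sup {\<rho>. \<rho> > 0 \<and> ball 0 \<rho> \<subseteq> f ` U})"

text \<open>For open \<open>M\<close> and \<open>p \<in> M\<close> the infimum is over a nonempty set.\<close>

definition kobayashi_metric :: "(complex ^ 'n) set \<Rightarrow> complex ^ 'n \<Rightarrow> complex ^ 'n \<Rightarrow> real" where
  "kobayashi_metric M p \<xi> =
     Inf {s. s > 0 \<and> (\<exists>\<phi> :: complex \<Rightarrow> complex ^ 'n.
            (\<forall>i. (\<lambda>t. \<phi> t $ i) holomorphic_on ball 0 1) \<and> \<phi> ` ball 0 1 \<subseteq> M \<and> \<phi> 0 = p \<and>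
            (\<forall>i. ((\<lambda>t. \<phi> t $ i) has_field_derivative \<xi> $ i / of_real s) (at 0)))}"

text \<open>Here \<^term>\<open>vec.dim\<close> is the dimension over the complex numbers.\<close>

definition kobayashi_corank_at :: "(complex ^ 'n) set \<Rightarrow> complex ^ 'n \<Rightarrow> nat" where
  "kobayashi_corank_at M p = vec.dim {\<xi>. kobayashi_metric M p \<xi> = 0}"

text \<open>The value at an arbitrarily chosen point of \<open>M\<close>: for the sets considered here
  the corank is the same at every point.\<close>

definition kobayashi_corank :: "(complex ^ 'n) set \<Rightarrow> nat" where
  "kobayashi_corank M = kobayashi_corank_at M (SOME p. p \<in> M)"

text \<open>Functions on \<open>M\<close> are represented by total functions vanishing off \<open>M\<close>,
  so that equality of representatives is equality on \<open>M\<close>.\<close>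

definition bergman_space :: "(complex ^ 'n) set \<Rightarrow> (complex ^ 'n \<Rightarrow> complex) set" where
  "bergman_space M =
     {f. holomorphic_fun_on f M \<and> (\<forall>z. z \<notin> M \<longrightarrow> f z = 0) \<and>
         (\<integral>\<^sup>+z\<in>M. ennreal ((cmod (f z))\<^sup>2) \<partial>lborel) < \<infinity>}"

interpretation cfun: vector_space "\<lambda>(c::complex) (f :: 'a \<Rightarrow> complex) x. c * f x"
  by unfold_locales (auto simp: fun_eq_iff algebra_simps)

text \<open>The library's \<^term>\<open>cfun.dim\<close> is 0 on infinite-dimensional spaces, hence the case split.\<close>

definition complex_dimension :: "('a \<Rightarrow> complex) set \<Rightarrow> enat" where
  "complex_dimension V =
     (if \<exists>B. finite B \<and> V \<subseteq> cfun.span B then enat (cfun.dim V) else \<infinity>)"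

end

theory Submission
  imports Defs
begin

text \<open>Fix \<open>p \<in> M\<close>.  For large \<open>n\<close> the squeezing bound gives an embedding \<open>f\<^sub>n\<close> of the \<open>n\<close>-th domain into
the unit ball with \<open>f\<^sub>n p = 0\<close> whose image contains \<open>ball 0 (r / 2)\<close>.  Everything is decided by the
complex Jacobian determinants \<open>J\<^sub>n\<close> of these maps, because a biholomorphic map transports square
integrable functions once they are multiplied by its Jacobian.

Suppose first that \<open>J\<^sub>n p\<close> comes arbitrarily close to \<open>0\<close>.  If \<open>F\<close> is in the Bergman space, the pull-back
\<open>(F \<circ> f\<^sub>n\<^sup>-\<^sup>1) / (J\<^sub>n \<circ> f\<^sub>n\<^sup>-\<^sup>1)\<close> is holomorphic on \<open>ball 0 (r / 2)\<close> with an \<open>L\<^sup>2\<close> norm that does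
not exceed that of \<open>F\<close>, so the mean value inequality bounds \<open>\<bar>F p / J\<^sub>n p\<bar>\<close> independently of \<open>n\<close>
(\<open>point_estimate_by_embedding\<close>).  Hence \<open>F p = 0\<close>.

Suppose next that \<open>J\<^sub>n p\<close> does not tend to \<open>0\<close>.  By Montel's theorem a subsequence of the \<open>f\<^sub>n\<close>
converges on \<open>M\<close> to a holomorphic map with Jacobian \<open>J\<close> and \<open>J p \<noteq> 0\<close>.  The integral of \<open>\<bar>J\<^sub>n\<bar>\<^sup>2\<close> is the
volume of the image of \<open>f\<^sub>n\<close>, hence at most the volume of the unit ball, and Fatou's lemma passes this
bound to \<open>J\<close>.  If \<open>u\<close> is a component of the limit map, then \<open>J\<close>, \<open>J u\<close>, \<open>J u\<^sup>2\<close>, ... all lie in the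
Bergman space, and they are linearly independent since \<open>u\<close> is not constant near \<open>p\<close>
(\<open>bergman_space_infinite_dimensional\<close>).

So a single \<open>F\<close> with \<open>F p \<noteq> 0\<close> at a single \<open>p\<close> excludes the first case and forces infinite dimension.
For the second claim let \<open>\<xi> \<noteq> 0\<close> have Kobayashi length \<open>0\<close> at \<open>p\<close>.  Cauchy's estimate on discs in \<open>M\<close> with large
derivative in direction \<open>\<xi>\<close> shows that the derivatives of the \<open>f\<^sub>n\<close> at \<open>p\<close> nearly annihilate \<open>\<xi>\<close>, so \<open>J\<^sub>n p\<close> comes close
to \<open>0\<close> (\<open>jacobian_small_of_kobayashi_zero\<close>) and the Bergman space vanishes at \<open>p\<close>.  If the volume of \<open>M\<close> were
finite, the constant \<open>1\<close> would be a counterexample.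

Two tools are developed on the way: the change of variables formula on \<open>\<complex>\<^sup>d\<close>, where the volume factor
of a complex-linear map is the squared modulus of its complex determinant, and Cauchy estimates of first
and second order, which let pointwise limits of bounded holomorphic functions be differentiated.\<close>

(* Only the vector component keeps the infix dollar sign. *)
no_notation fps_nth (infixl \<open>$\<close> 75)

section \<open>The real volume factor of a complex-linear map\<close>

abbreviation complex_linear :: "(complex ^ 'n \<Rightarrow> complex ^ 'm) \<Rightarrow> bool" where
  "complex_linear \<equiv> Vector_Spaces.linear (*s) (*s)"

definition coordinate_swap :: "'n \<Rightarrow> 'n \<Rightarrow> complex ^ 'n \<Rightarrow> complex ^ 'n" where
  "coordinate_swap k l x = (\<chi> i. x $ Transposition.transpose k l i)"

definition dilation_on :: "'n set \<Rightarrow> complex \<Rightarrow> complex ^ 'n \<Rightarrow> complex ^ 'n" where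
  "dilation_on A c x = (\<chi> i. if i \<in> A then c * x $ i else x $ i)"

definition shear :: "'n \<Rightarrow> complex ^ 'n \<Rightarrow> complex ^ 'n \<Rightarrow> complex ^ 'n" where
  "shear k w x = x + x $ k *s w"

lemma complex_linear_coordinate_swap: "complex_linear (coordinate_swap k l)"
  unfolding coordinate_swap_def by unfold_locales (auto simp: vec_eq_iff)

lemma complex_linear_dilation_on: "complex_linear (dilation_on A c)"
  unfolding dilation_on_def by unfold_locales (auto simp: vec_eq_iff algebra_simps)

lemma complex_linear_shear: "complex_linear (shear k w)"
  unfolding shear_def by unfold_locales (auto simp: vec_eq_iff algebra_simps)

lemmas complex_linear_elementary =
  complex_linear_coordinate_swap complex_linear_dilation_on complex_linear_shear

lemma coordinate_swap_involution: "coordinate_swap k l \<circ> coordinate_swap k l = id"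
  by (auto simp: fun_eq_iff coordinate_swap_def vec_eq_iff)

lemma complex_linear_compose:
  "complex_linear f \<Longrightarrow> complex_linear g \<Longrightarrow> complex_linear (g \<circ> f)"
  by (rule Vector_Spaces.linear_compose)

lemma complex_linear_expansion:
  fixes f :: "complex ^ 'n \<Rightarrow> complex ^ 'm"
  assumes "complex_linear f"
  shows "f x = (\<Sum>j\<in>UNIV. x $ j *s f (axis j 1))"
proof -
  interpret f: Vector_Spaces.linear "(*s)" "(*s)" f by fact
  have "x = (\<Sum>j\<in>UNIV. x $ j *s axis j 1)"
    by (simp add: basis_expansion)
  then have "f x = f (\<Sum>j\<in>UNIV. x $ j *s axis j 1)" by simp
  then show ?thesis by (simp add: f.sum f.scale)
qed

text \<open>The properties of the volume factor of a complex-linear map that suffice to identify it with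
\<open>\<lambda>f. \<bar>det f\<bar>\<^sup>2\<close>.  Both functions satisfy them, which avoids expanding a real determinant of
twice the size.\<close>

locale det_square_like =
  fixes \<mu> :: "(complex ^ 'n \<Rightarrow> complex ^ 'n) \<Rightarrow> real"
  assumes mult: "complex_linear f \<Longrightarrow> complex_linear g \<Longrightarrow> \<mu> (f \<circ> g) = \<mu> f * \<mu> g"
    and scalar: "\<mu> ((*s) c) = cmod c ^ (2 * CARD('n))"
    and nonneg: "\<mu> f \<ge> 0"
begin

lemma at_id: "\<mu> id = 1"
proof -
  have "((*s) 1 :: complex ^ 'n \<Rightarrow> complex ^ 'n) = id"
    by (auto simp: fun_eq_iff)
  with scalar[of 1] show ?thesis by simp
qed

lemma at_involution:
  assumes "complex_linear f" "f \<circ> f = id"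
  shows "\<mu> f = 1"
proof -
  have "\<mu> f * \<mu> f = 1"
    using mult[OF assms(1) assms(1)] assms(2) at_id by simp
  then show ?thesis
    using nonneg[of f] by (simp add: square_eq_1_iff)
qed

lemma at_swap: "\<mu> (coordinate_swap k l) = 1"
  by (rule at_involution) (auto intro: complex_linear_elementary coordinate_swap_involution)

text \<open>Scaling all coordinates by \<open>c\<close> is the composition of the \<open>d\<close> dilations of one coordinate, and these are
conjugate to each other by coordinate swaps.  So the \<open>d\<close>-th power of the value sought is \<open>\<bar>c\<bar>\<^sup>2\<^sup>d\<close>.\<close>

lemma at_dilation: "\<mu> (dilation_on {k} c) = cmod c ^ 2"
proof -
  have same: "\<mu> (dilation_on {l} c) = \<mu> (dilation_on {k} c)" for l
  proof -
    have "dilation_on {l} c = coordinate_swap k l \<circ> (dilation_on {k} c \<circ> coordinate_swap k l)"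
      by (auto simp: fun_eq_iff dilation_on_def coordinate_swap_def vec_eq_iff Transposition.transpose_def)
    then show ?thesis
      by (simp add: mult complex_linear_elementary complex_linear_compose at_swap)
  qed
  have "\<mu> (dilation_on A c) = \<mu> (dilation_on {k} c) ^ card A" for A
  proof -
    have "finite A" by simp
    then show ?thesis
    proof (induction A)
      case empty
      have "(dilation_on {} c :: complex ^ 'n \<Rightarrow> _) = id"
        by (auto simp: fun_eq_iff dilation_on_def vec_eq_iff)
      then show ?case using at_id by (metis card.empty power_0)
    next
      case (insert j A)
      have "dilation_on (insert j A) c = dilation_on {j} c \<circ> dilation_on A c"
        using insert(2) by (auto simp: fun_eq_iff dilation_on_def vec_eq_iff)
      then have "\<mu> (dilation_on (insert j A) c) = \<mu> (dilation_on {j} c) * \<mu> (dilation_on A c)"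
        by (metis mult complex_linear_dilation_on)
      then show ?case
        using insert by (simp add: same[of j])
    qed
  qed
  from this[of UNIV] have "\<mu> (dilation_on {k} c) ^ CARD('n) = \<mu> (dilation_on UNIV c)" by simp
  also have "(dilation_on UNIV c :: complex ^ 'n \<Rightarrow> _) = (*s) c"
    by (auto simp: fun_eq_iff dilation_on_def vec_eq_iff)
  finally have "\<mu> (dilation_on {k} c) ^ CARD('n) = (cmod c ^ 2) ^ CARD('n)"
    by (simp add: scalar power_mult)
  then show ?thesis
    by (rule power_eq_imp_eq_base) (auto intro: nonneg)
qed

lemma at_shear:
  assumes "w $ k = 0"
  shows "\<mu> (shear k w) = 1"
proof -
  let ?D = "dilation_on {k} (-1) :: complex ^ 'n \<Rightarrow> _"
  \<comment> \<open>Conjugation by the reflection in the \<open>k\<close>-th coordinate inverts the shear.\<close>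
  have "shear k w \<circ> (?D \<circ> (shear k w \<circ> ?D)) = id"
    using assms by (auto simp: fun_eq_iff dilation_on_def shear_def vec_eq_iff)
  then have "\<mu> (shear k w) * \<mu> (shear k w) = 1"
    using mult[of "shear k w" "?D \<circ> (shear k w \<circ> ?D)"] mult[of ?D "shear k w \<circ> ?D"]
      mult[of "shear k w" ?D] at_dilation[of k "-1"] at_id
    by (simp add: complex_linear_elementary complex_linear_compose)
  then show ?thesis
    using nonneg[of "shear k w"] by (simp add: square_eq_1_iff)
qed

lemma at_column_replacement:
  assumes "v $ k \<noteq> 0"
  shows "\<mu> (shear k (v - axis k 1)) = cmod (v $ k) ^ 2"
proof -
  let ?w = "(1 / v $ k) *s (v - v $ k *s axis k 1)"
  have "shear k (v - axis k 1) = shear k ?w \<circ> dilation_on {k} (v $ k)"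
    using assms by (auto simp: fun_eq_iff dilation_on_def shear_def vec_eq_iff axis_def field_simps)
  moreover have "\<mu> (shear k ?w) = 1"
    by (rule at_shear) (simp add: axis_def)
  ultimately show ?thesis
    by (simp add: mult complex_linear_elementary at_dilation)
qed

end

text \<open>Every invertible map is a composition of coordinate swaps and of maps that replace one basis vector
by another vector: the basis vectors are turned into their images one at a time, as in the
exchange lemma.  On these two kinds of maps the axioms determine the value.\<close>

lemma det_square_like_unique:
  fixes \<mu> \<nu> :: "(complex ^ 'n \<Rightarrow> complex ^ 'n) \<Rightarrow> real"
  assumes "det_square_like \<mu>" "det_square_like \<nu>"
    and "complex_linear f" "inj f"
  shows "\<mu> f = \<nu> f"
proof -
  interpret \<mu>: det_square_like \<mu> by fact
  interpret \<nu>: det_square_like \<nu> by fact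
  have "\<mu> f = \<nu> f" if "complex_linear f" "inj f" "\<forall>j\<in>S. f (axis j 1) = axis j 1" for S f
    using that
  proof (induction "card (UNIV - S)" arbitrary: S f)
    case 0
    then have basis: "f (axis j 1) = axis j 1" for j
      by auto
    have "f x = x" for x
      using complex_linear_expansion[OF 0(2), of x] by (simp add: basis basis_expansion)
    then have "f = id"
      by auto
    then show ?case using \<mu>.at_id \<nu>.at_id by metis
  next
    case (Suc m)
    then obtain k where k: "k \<notin> S"
      by (metis Diff_eq_empty_iff UNIV_I card.empty nat.distinct(1) subsetI)
    interpret f: Vector_Spaces.linear "(*s)" "(*s)" f by fact
    \<comment> \<open>Otherwise the image of the \<open>k\<close>-th basis vector is in the span of the fixed ones, against injectivity.\<close>
    have "\<exists>l. l \<notin> S \<and> f (axis k 1) $ l \<noteq> 0"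
    proof (rule ccontr)
      assume *: "\<not> ?thesis"
      let ?a = "f (axis k 1)"
      let ?b = "\<chi> j. if j \<in> S then ?a $ j else 0"
      have "f ?b = (\<Sum>j\<in>UNIV. ?b $ j *s f (axis j 1))"
        by (rule complex_linear_expansion[OF Suc(3)])
      also have "\<dots> = (\<Sum>j\<in>UNIV. ?a $ j *s axis j 1)"
        using * Suc(5) by (intro sum.cong) auto
      also have "\<dots> = ?a" by (simp add: basis_expansion)
      finally have "?b = axis k 1"
        using Suc(4) by (simp add: inj_eq)
      then have "?b $ k = 1" by simp
      with k show False by simp
    qed
    then obtain l where l: "l \<notin> S" "f (axis k 1) $ l \<noteq> 0" by blast
    define g where "g = coordinate_swap k l \<circ> f"
    define v where "v = g (axis k 1)"
    have vk: "v $ k \<noteq> 0"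
      using l by (simp add: v_def g_def coordinate_swap_def)
    have gS: "g (axis j 1) = axis j 1" if "j \<in> S" for j
      using that Suc(5) k l
      by (auto simp: g_def coordinate_swap_def vec_eq_iff axis_def Transposition.transpose_def)
    \<comment> \<open>the inverse of the map that sends the \<open>k\<close>-th basis vector to \<open>v\<close> and fixes the others\<close>
    define E where "E = shear k (- (1 / v $ k) *s (v - axis k 1))"
    define h where "h = E \<circ> g"
    have lin: "complex_linear g" "complex_linear E" "complex_linear h"
      using Suc(3) by (auto simp: g_def h_def E_def intro!: complex_linear_compose complex_linear_elementary)
    have RE: "shear k (v - axis k 1) \<circ> E = id"
      using vk by (auto simp: fun_eq_iff E_def shear_def vec_eq_iff axis_def field_simps)
    have "shear k (v - axis k 1) \<circ> h = (shear k (v - axis k 1) \<circ> E) \<circ> g"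
      by (simp add: h_def comp_assoc)
    then have gh: "g = shear k (v - axis k 1) \<circ> h"
      using RE by simp
    have fg: "f = coordinate_swap k l \<circ> g"
      using coordinate_swap_involution[of k l] by (simp add: g_def comp_assoc[symmetric])
    have "inj h"
      using Suc(4) unfolding fg gh by (metis inj_on_imageI2 comp_assoc)
    moreover have "h (axis j 1) = axis j 1" if "j \<in> insert k S" for j
    proof (cases "j = k")
      case True
      have "E v = axis k 1"
        using vk by (auto simp: E_def shear_def vec_eq_iff axis_def field_simps)
      then show ?thesis using True by (simp add: h_def v_def)
    next
      case False
      with that gS have "g (axis j 1) = axis j 1" by auto
      then show ?thesis using False
        by (auto simp: h_def E_def shear_def vec_eq_iff axis_def)
    qed
    moreover have "m = card (UNIV - insert k S)"
      using Suc(2) k by (metis DiffI Diff_insert UNIV_I card_Diff_singleton diff_Suc_1)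
    ultimately have "\<mu> h = \<nu> h"
      using Suc(1) lin by blast
    then show ?case
      unfolding fg gh using lin vk
      by (simp add: \<mu>.mult \<nu>.mult complex_linear_elementary complex_linear_compose
          \<mu>.at_swap \<nu>.at_swap \<mu>.at_column_replacement \<nu>.at_column_replacement)
  qed
  from this[of f "{}"] assms show ?thesis by auto
qed

lemma matrix_scalar: "matrix ((*s) c :: complex ^ 'n \<Rightarrow> complex ^ 'n) = mat c"
  by (simp add: matrix_def mat_def axis_def vec_eq_iff)

lemma det_square_like_complex_det:
  "det_square_like (\<lambda>f :: complex ^ 'n \<Rightarrow> complex ^ 'n. (cmod (det (matrix f)))\<^sup>2)"
proof
  show "(cmod (det (matrix ((*s) c :: complex ^ 'n \<Rightarrow> complex ^ 'n))))\<^sup>2 = cmod c ^ (2 * CARD('n))" for c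
  proof -
    have "det (mat c :: complex ^ 'n ^ 'n) = (\<Prod>i\<in>UNIV. (mat c :: complex ^ 'n ^ 'n) $ i $ i)"
      by (rule det_diagonal) (simp add: mat_def)
    then show ?thesis
      by (simp add: matrix_scalar mat_def norm_power mult.commute flip: power_mult)
  qed
qed (auto simp: matrix_compose_gen det_mul norm_mult power_mult_distrib)

section \<open>Change of variables\<close>

lemma norm_vector_scalar_mult: "norm (c *s x) = cmod c * norm (x :: complex ^ 'n)"
  by (simp add: norm_vec_def norm_mult L2_set_right_distrib)

text \<open>The change of variables theorem for absolutely integrable functions, restated for nonnegative
integrals over \<open>lborel\<close>.  The theorem is about vector-valued functions, hence the detour through \<open>real ^ 1\<close>.\<close>

lemma nn_integral_change_of_variables_real:
  fixes g :: "real ^ 'N::{finite,wellorder} \<Rightarrow> real ^ 'N::_" and h :: "real ^ 'N::_ \<Rightarrow> real"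
  assumes U: "open U" and gU: "open (g ` U)"
    and der: "\<And>x. x \<in> U \<Longrightarrow> (g has_derivative g' x) (at x)"
    and inj: "inj_on g U"
    and h: "h \<in> borel_measurable borel" "\<And>x. 0 \<le> h x"
    and fin: "(\<integral>\<^sup>+x\<in>g ` U. ennreal (h x) \<partial>lborel) < \<infinity>"
  shows "(\<integral>\<^sup>+x\<in>U. ennreal (\<bar>det (matrix (g' x))\<bar> * h (g x)) \<partial>lborel) =
    (\<integral>\<^sup>+x\<in>g ` U. ennreal (h x) \<partial>lborel)"
proof -
  let ?D = "\<lambda>x. \<bar>det (matrix (g' x))\<bar> * h (g x)"
  have nn_set: "(\<integral>\<^sup>+x\<in>S. ennreal (f x) \<partial>lborel) = ennreal (integral S f)"
    if "f absolutely_integrable_on S" "\<And>x. 0 \<le> f x" for S and f :: "real ^ 'N::_ \<Rightarrow> real"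
  proof -
    have "(\<integral>\<^sup>+x\<in>S. ennreal (f x) \<partial>lborel) = (\<integral>\<^sup>+x. ennreal (indicator S x * f x) \<partial>lebesgue)"
      by (subst nn_integral_completion) (auto intro!: nn_integral_cong split: split_indicator)
    also have "\<dots> = ennreal (integral\<^sup>L lebesgue (\<lambda>x. indicator S x * f x))"
      using that by (intro nn_integral_eq_integral) (auto simp: set_integrable_def)
    also have "integral\<^sup>L lebesgue (\<lambda>x. indicator S x * f x) = integral S f"
      using set_lebesgue_integral_eq_integral(2)[OF that(1)] by (simp add: set_lebesgue_integral_def)
    finally show ?thesis .
  qed
  have meas: "(\<lambda>x. indicator (g ` U) x * h x) \<in> borel_measurable lborel"
    using h(1) gU by simp
  have "integrable lborel (\<lambda>x. indicator (g ` U) x * h x)"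
  proof (rule integrableI_nonneg)
    show "(\<integral>\<^sup>+x. ennreal (indicator (g ` U) x * h x) \<partial>lborel) < \<infinity>"
      using fin by (rule back_subst[of "\<lambda>z. z < \<infinity>"])
        (auto intro!: nn_integral_cong split: split_indicator)
  qed (use meas h in auto)
  then have hint: "h absolutely_integrable_on (g ` U)"
    using meas by (simp add: set_integrable_def integrable_completion)
  have "(\<lambda>x. \<bar>det (matrix (g' x))\<bar> *\<^sub>R (vec (h (g x)) :: real ^ 1)) absolutely_integrable_on U \<and>
      integral U (\<lambda>x. \<bar>det (matrix (g' x))\<bar> *\<^sub>R (vec (h (g x)) :: real ^ 1)) = vec (integral (g ` U) h)"
  proof (subst has_absolute_integral_change_of_variables[where f="\<lambda>x. vec (h x) :: real ^ 1"])
    show "U \<in> sets lebesgue" using U by (simp add: borel_open)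
    show "(g has_derivative g' x) (at x within U)" if "x \<in> U" for x
      using der[OF that] has_derivative_at_withinI by blast
    show "(\<lambda>x. vec (h x) :: real ^ 1) absolutely_integrable_on (g ` U) \<and>
        integral (g ` U) (\<lambda>x. vec (h x) :: real ^ 1) = vec (integral (g ` U) h)"
      using hint by (simp add: absolutely_integrable_on_1_iff integral_on_1_eq)
  qed fact
  then have "?D absolutely_integrable_on U" "integral U ?D = integral (g ` U) h"
    by (auto simp: absolutely_integrable_on_1_iff integral_on_1_eq)
  then show ?thesis
    using nn_set[of U ?D] nn_set[of "g ` U" h] hint h(2) by simp
qed

text \<open>Real coordinates in which the real change of variables theorem can be applied.  The index type has
\<open>2 d\<close> elements and carries the well-order that the theorem requires.\<close>

lemma isometric_real_coordinates:
  obtains T :: "complex ^ 'n \<Rightarrow> real ^ ('n bit0)" and T' where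
    "linear T" "linear T'" "\<And>x. T' (T x) = x" "\<And>y. T (T' y) = y"
    "\<And>x. norm (T x) = norm x" "distr lborel borel T = lborel"
proof -
  have "card (Basis :: (complex ^ 'n) set) = CARD('n bit0)"
    by (simp add: DIM_complex)
  then obtain \<beta> :: "'n bit0 \<Rightarrow> complex ^ 'n" where \<beta>: "bij_betw \<beta> UNIV Basis"
    by (metis finite_Basis finite_same_card_bij finite_class.finite_UNIV)
  define T :: "complex ^ 'n \<Rightarrow> real ^ ('n bit0)" where "T = (\<lambda>x. \<chi> k. x \<bullet> \<beta> k)"
  define T' :: "real ^ ('n bit0) \<Rightarrow> complex ^ 'n" where "T' = (\<lambda>y. \<Sum>k\<in>UNIV. y $ k *\<^sub>R \<beta> k)"
  have sum_\<beta>: "(\<Sum>k\<in>UNIV. F (\<beta> k)) = (\<Sum>b\<in>Basis. F b)" for F :: "_ \<Rightarrow> 'b::comm_monoid_add"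
    by (rule sum.reindex_bij_betw[OF \<beta>])
  have \<beta>B: "\<beta> k \<in> Basis" for k
    using \<beta> by (auto simp: bij_betw_def)
  have \<beta>in: "\<beta> j \<bullet> \<beta> k = (if j = k then 1 else 0)" for j k
    using \<beta> \<beta>B by (auto simp: inner_Basis bij_betw_def inj_eq)
  have T'T: "T' (T x) = x" for x
    using sum_\<beta>[of "\<lambda>b. (x \<bullet> b) *\<^sub>R b"] by (simp add: T_def T'_def euclidean_representation)
  have TT': "T (T' y) = y" for y
    by (simp add: T_def T'_def vec_eq_iff inner_sum_left \<beta>in sum.delta' if_distrib cong: if_cong)
  have linT: "linear T"
    by (rule linearI) (auto simp: T_def vec_eq_iff inner_add_left)
  have linT': "linear T'"
    by (rule linearI) (auto simp: T'_def scaleR_add_left sum.distrib scaleR_sum_right)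
  have normT: "norm (T x) = norm x" for x
    using sum_\<beta>[of "\<lambda>b. (x \<bullet> b)\<^sup>2"]
    by (simp add: T_def norm_eq_sqrt_inner[of x] euclidean_inner[of x x] power2_eq_square)
       (simp add: norm_vec_def L2_set_def power2_eq_square)
  have meas: "T \<in> borel_measurable borel"
    using linT by (intro borel_measurable_continuous_onI linear_continuous_on linear_conv_bounded_linear[THEN iffD1])
  have "lborel = distr lborel borel T"
  proof (rule lborel_eqI)
    fix l u :: "real ^ ('n bit0)"
    assume le: "\<And>b. b \<in> Basis \<Longrightarrow> l \<bullet> b \<le> u \<bullet> b"
    then have le': "l $ k \<le> u $ k" for k
      using le[of "axis k 1"] by (simp add: inner_axis axis_in_Basis_iff)
    have T'\<beta>: "T' y \<bullet> \<beta> k = y $ k" for y k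
      using TT'[of y] by (metis T_def vec_lambda_beta)
    have all: "(\<forall>b\<in>Basis. P b) \<longleftrightarrow> (\<forall>k. P (\<beta> k))" for P
      using \<beta> by (auto simp: bij_betw_def) (metis image_iff)
    have "T -` box l u = box (T' l) (T' u)"
      by (auto simp: box_def all T'\<beta> T_def)
         (auto simp: Basis_vec_def inner_axis)
    then have "emeasure (distr lborel borel T) (box l u) = emeasure lborel (box (T' l) (T' u))"
      using meas by (simp add: emeasure_distr)
    also have "\<dots> = ennreal (\<Prod>b\<in>Basis. (T' u - T' l) \<bullet> b)"
      using le' all[of "\<lambda>b. T' l \<bullet> b \<le> T' u \<bullet> b"]
      by (intro emeasure_lborel_box) (auto simp: T'\<beta>)
    also have "(\<Prod>b\<in>Basis. (T' u - T' l) \<bullet> b) = (\<Prod>k\<in>UNIV. (T' u - T' l) \<bullet> \<beta> k)"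
      by (rule prod.reindex_bij_betw[OF \<beta>, symmetric])
    also have "\<dots> = (\<Prod>k\<in>UNIV. (u - l) $ k)"
      by (simp add: inner_diff_left T'\<beta>)
    also have "\<dots> = (\<Prod>b\<in>Basis. (u - l) \<bullet> b)"
      by (simp add: Basis_vec_def UNION_singleton_eq_range prod.reindex inj_on_def axis_eq_axis inner_axis)
    finally show "emeasure (distr lborel borel T) (box l u) = ennreal (\<Prod>b\<in>Basis. (u - l) \<bullet> b)" .
  qed simp
  with linT linT' T'T TT' normT that show ?thesis by metis
qed

lemma scaleR_eq_vector_scalar_mult: "r *\<^sub>R x = complex_of_real r *s (x :: complex ^ 'n)"
  by (simp add: vec_eq_iff) (simp add: scaleR_conv_of_real)

lemma complex_linear_imp_linear:
  assumes "complex_linear f"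
  shows "linear f"
proof -
  interpret f: Vector_Spaces.linear "(*s)" "(*s)" f by fact
  show ?thesis
    by (rule linearI) (simp_all only: scaleR_eq_vector_scalar_mult f.add f.scale)
qed

text \<open>The real determinant is multiplicative, and the scalar \<open>c\<close> is a homothety by \<open>\<bar>c\<bar>\<close> after an
orthogonal map, so its real determinant is \<open>\<bar>c\<bar>\<^sup>2\<^sup>d\<close> up to sign.\<close>

lemma real_det_complex_linear:
  fixes T :: "complex ^ 'n \<Rightarrow> real ^ ('n bit0)" and f :: "complex ^ 'n \<Rightarrow> complex ^ 'n"
  assumes T: "linear T" "linear T'" "\<And>x. T' (T x) = x" "\<And>y. T (T' y) = y" "\<And>x. norm (T x) = norm x"
    and f: "complex_linear f" "inj f"
  shows "\<bar>det (matrix (T \<circ> f \<circ> T'))\<bar> = (cmod (det (matrix f)))\<^sup>2"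
proof -
  have lin: "linear (T \<circ> f \<circ> T')" if "complex_linear f" for f
    using that T by (intro linear_compose complex_linear_imp_linear)
  have "det_square_like (\<lambda>f. \<bar>det (matrix (T \<circ> f \<circ> T'))\<bar>)"
  proof
    fix f g :: "complex ^ 'n \<Rightarrow> complex ^ 'n" assume fg: "complex_linear f" "complex_linear g"
    have "T \<circ> (f \<circ> g) \<circ> T' = (T \<circ> f \<circ> T') \<circ> (T \<circ> g \<circ> T')"
      by (auto simp: fun_eq_iff T)
    then show "\<bar>det (matrix (T \<circ> (f \<circ> g) \<circ> T'))\<bar> = \<bar>det (matrix (T \<circ> f \<circ> T'))\<bar> * \<bar>det (matrix (T \<circ> g \<circ> T'))\<bar>"
      using lin fg by (simp add: matrix_compose det_mul abs_mult del: o_apply)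
  next
    fix c :: complex
    obtain w where w: "c = complex_of_real (cmod c) * w" "cmod w = 1"
      by (cases "c = 0") (auto intro: that[of 1] that[of "sgn c"] simp: sgn_div_norm norm_divide scaleR_conv_of_real field_simps)
    have "orthogonal_transformation (T \<circ> (*s) w \<circ> T')"
    proof -
      have "complex_linear ((*s) w :: complex ^ 'n \<Rightarrow> _)"
        by unfold_locales (auto simp: vec_eq_iff algebra_simps)
      then show ?thesis
        using lin w T by (simp add: orthogonal_transformation norm_vector_scalar_mult) (metis T(4) T(5))
    qed
    then have 1: "\<bar>det (matrix (T \<circ> (*s) w \<circ> T'))\<bar> = 1" 
      by (rule orthogonal_transformation_det)
    have "T \<circ> (*s) c \<circ> T' = (*\<^sub>R) (cmod c) \<circ> (T \<circ> (*s) w \<circ> T')"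
    proof
      fix y
      have "c *s T' y = cmod c *\<^sub>R (w *s T' y)"
        by (subst w(1)) (simp add: vec_eq_iff, simp add: scaleR_conv_of_real)
      then show "(T \<circ> (*s) c \<circ> T') y = ((*\<^sub>R) (cmod c) \<circ> (T \<circ> (*s) w \<circ> T')) y"
        using T(1) by (simp add: linear_scale)
    qed
    moreover have "linear (T \<circ> (*s) w \<circ> T')"
      by (rule lin) (unfold_locales, auto simp: vec_eq_iff algebra_simps)
    moreover have "linear ((*\<^sub>R) (cmod c) :: real ^ ('n bit0) \<Rightarrow> _)"
      by (rule linear_scaleR)
    ultimately have "matrix (T \<circ> (*s) c \<circ> T') = mat (cmod c) ** matrix (T \<circ> (*s) w \<circ> T')"
      by (simp only: matrix_compose matrix_scaleR)
    moreover have "det (mat (cmod c) :: real ^ ('n bit0) ^ ('n bit0)) = cmod c ^ (2 * CARD('n))"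
      by (subst det_diagonal) (auto simp: mat_def)
    ultimately show "\<bar>det (matrix (T \<circ> (*s) c \<circ> T'))\<bar> = cmod c ^ (2 * CARD('n))"
      using 1 by (simp add: det_mul abs_mult)
  qed simp
  from det_square_like_unique[OF this det_square_like_complex_det f] show ?thesis .
qed

lemma nn_integral_change_of_variables_holomorphic:
  fixes g :: "complex ^ 'n \<Rightarrow> complex ^ 'n" and h :: "complex ^ 'n \<Rightarrow> real"
  assumes U: "open U" and gU: "open (g ` U)"
    and der: "\<And>x. x \<in> U \<Longrightarrow> (g has_derivative g' x) (at x)"
    and lin: "\<And>x. x \<in> U \<Longrightarrow> complex_linear (g' x) \<and> inj (g' x)"
    and inj: "inj_on g U"
    and h: "h \<in> borel_measurable borel" "\<And>x. 0 \<le> h x"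
    and fin: "(\<integral>\<^sup>+x\<in>g ` U. ennreal (h x) \<partial>lborel) < \<infinity>"
    and J: "(\<lambda>x. indicator U x *\<^sub>R det (matrix (g' x))) \<in> borel_measurable borel"
  shows "(\<integral>\<^sup>+x\<in>U. ennreal ((cmod (det (matrix (g' x))))\<^sup>2 * h (g x)) \<partial>lborel) =
    (\<integral>\<^sup>+x\<in>g ` U. ennreal (h x) \<partial>lborel)"
proof -
  obtain T :: "complex ^ 'n \<Rightarrow> real ^ ('n bit0)" and T' where
    T: "linear T" "linear T'" "\<And>x. T' (T x) = x" "\<And>y. T (T' y) = y" "\<And>x. norm (T x) = norm x"
    and distrT: "distr lborel borel T = lborel"
    using isometric_real_coordinates by metis
  have bl: "bounded_linear T" "bounded_linear T'"
    using T by (auto simp: linear_conv_bounded_linear)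
  have contT: "continuous_on S T" and contT': "continuous_on S' T'" for S S'
    using bl by (auto intro: linear_continuous_on)
  have [measurable]: "T \<in> borel_measurable borel" "T' \<in> borel_measurable borel"
    using contT contT' by (auto intro: borel_measurable_continuous_onI)
  have [measurable]: "U \<in> sets borel" "g ` U \<in> sets borel"
    using U gU by auto
  have image: "T ` S = T' -` S" for S
    using T by (metis bij_image_Collect_eq bij_iff bij_vimage_eq_inv_image inv_equality)
  have open_image: "open (T ` S)" if "open S" for S
    using that contT' by (simp add: image open_vimage)
  have transfer: "(\<integral>\<^sup>+y\<in>T ` S. F y \<partial>lborel) = (\<integral>\<^sup>+x\<in>S. F (T x) \<partial>lborel)"
    if "(\<lambda>x. F (T x) * indicator S x) \<in> borel_measurable borel" for S and F :: "_ \<Rightarrow> ennreal"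
  proof -
    have "(\<lambda>y. F y * indicator (T ` S) y) = (\<lambda>x. F (T x) * indicator S x) \<circ> T'"
      using T by (auto simp: fun_eq_iff image indicator_def)
    then have "(\<lambda>y. F y * indicator (T ` S) y) \<in> borel_measurable borel"
      using measurable_comp[OF \<open>T' \<in> borel_measurable borel\<close> that] by simp
    then have "(\<integral>\<^sup>+y\<in>T ` S. F y \<partial>distr lborel borel T) = (\<integral>\<^sup>+x. F (T x) * indicator (T ` S) (T x) \<partial>lborel)"
      by (subst nn_integral_distr) auto
    also have "\<dots> = (\<integral>\<^sup>+x\<in>S. F (T x) \<partial>lborel)"
      using T by (intro nn_integral_cong) (auto simp: image indicator_def)
    finally show ?thesis by (simp add: distrT)
  qed
  let ?g = "T \<circ> g \<circ> T'" and ?g' = "\<lambda>y. T \<circ> g' (T' y) \<circ> T'" and ?h = "h \<circ> T'"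
  have gimage: "?g ` (T ` U) = T ` (g ` U)"
    using T by (auto simp: image_iff)
  have contg: "continuous_on U g"
    using der by (meson continuous_at_imp_continuous_on has_derivative_continuous)
  have fin': "(\<integral>\<^sup>+y\<in>T ` (g ` U). ennreal (?h y) \<partial>lborel) = (\<integral>\<^sup>+x\<in>g ` U. ennreal (h x) \<partial>lborel)"
    using gU h by (subst transfer) (auto simp: T)
  have "(\<integral>\<^sup>+y\<in>T ` U. ennreal (\<bar>det (matrix (?g' y))\<bar> * ?h (?g y)) \<partial>lborel) =
      (\<integral>\<^sup>+y\<in>?g ` (T ` U). ennreal (?h y) \<partial>lborel)"
  proof (rule nn_integral_change_of_variables_real)
    show "open (T ` U)" using U open_image by blast
    show "open (?g ` T ` U)" unfolding gimage using gU open_image by blast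
    show "(?g has_derivative ?g' y) (at y)" if "y \<in> T ` U" for y
    proof -
      have "T' y \<in> U" using that T by auto
      then have "(g has_derivative g' (T' y)) (at (T' y))" by (rule der)
      then show ?thesis
        using bl by (intro diff_chain_at) (auto intro: bounded_linear_imp_has_derivative)
    qed
    show "inj_on ?g (T ` U)"
      using inj T by (auto simp: inj_on_def) metis
    show "?h \<in> borel_measurable borel"
      using h(1) by (intro measurable_comp) auto
    show "(\<integral>\<^sup>+y\<in>?g ` T ` U. ennreal (?h y) \<partial>lborel) < \<infinity>"
      unfolding gimage fin' using fin .
  qed (use h in auto)
  also have "\<dots> = (\<integral>\<^sup>+x\<in>g ` U. ennreal (h x) \<partial>lborel)"
    unfolding gimage fin' ..
  finally have *: "(\<integral>\<^sup>+y\<in>T ` U. ennreal (\<bar>det (matrix (?g' y))\<bar> * ?h (?g y)) \<partial>lborel) = \<dots>" .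
  have eq: "ennreal (\<bar>det (matrix (?g' (T x)))\<bar> * ?h (?g (T x))) * indicator U x
      = ennreal ((cmod (det (matrix (g' x))))\<^sup>2 * h (g x)) * indicator U x" for x
    using real_det_complex_linear[OF T, of "g' x"] lin[of x] T
    by (auto simp: indicator_def)
  have "(\<integral>\<^sup>+y\<in>T ` U. ennreal (\<bar>det (matrix (?g' y))\<bar> * ?h (?g y)) \<partial>lborel)
      = (\<integral>\<^sup>+x\<in>U. ennreal (\<bar>det (matrix (?g' (T x)))\<bar> * ?h (?g (T x))) \<partial>lborel)"
  proof (rule transfer)
    have gm: "(\<lambda>x. indicator U x *\<^sub>R g x) \<in> borel_measurable borel"
      using contg U by (intro borel_measurable_continuous_on_indicator) auto
    have "(\<lambda>x. (cmod (indicator U x *\<^sub>R det (matrix (g' x))))\<^sup>2 * h (indicator U x *\<^sub>R g x)) \<in> borel_measurable borel"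
      using J gm h(1) by measurable
    then have "(\<lambda>x. ennreal ((cmod (indicator U x *\<^sub>R det (matrix (g' x))))\<^sup>2 * h (indicator U x *\<^sub>R g x)) * indicator U x) \<in> borel_measurable borel"
      using U by measurable
    also have "(\<lambda>x. ennreal ((cmod (indicator U x *\<^sub>R det (matrix (g' x))))\<^sup>2 * h (indicator U x *\<^sub>R g x)) * indicator U x) =
       (\<lambda>x. ennreal (\<bar>det (matrix (?g' (T x)))\<bar> * ?h (?g (T x))) * indicator U x)"
      unfolding eq by (auto simp: indicator_def fun_eq_iff)
    finally show "(\<lambda>x. ennreal (\<bar>det (matrix (?g' (T x)))\<bar> * ?h (?g (T x))) * indicator U x) \<in> borel_measurable borel" .
  qed
  then show ?thesis
    using * unfolding eq by simp
qed

section \<open>Holomorphic functions of several variables\<close>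

abbreviation complex_functional :: "(complex ^ 'n \<Rightarrow> complex) \<Rightarrow> bool" where
  "complex_functional \<equiv> Vector_Spaces.linear (*s) (*)"

lemma complex_functionalI:
  assumes "\<And>x y. L (x + y) = L x + L y" "\<And>c x. L (c *s x) = c * L x"
  shows "complex_functional L"
  using assms by unfold_locales (auto simp: algebra_simps)

lemma complex_functional_add: "complex_functional L \<Longrightarrow> L (x + y) = L x + L y"
  by (rule module_hom.add[OF Vector_Spaces.linear.axioms(3)])

lemma complex_functional_scale: "complex_functional L \<Longrightarrow> L (c *s x) = c * L x"
  by (rule module_hom.scale[OF Vector_Spaces.linear.axioms(3)])

lemma holomorphic_fun_onI:
  assumes "\<And>z. z \<in> U \<Longrightarrow> \<exists>L. complex_functional L \<and> (f has_derivative L) (at z)"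
  shows "holomorphic_fun_on f U"
  unfolding holomorphic_fun_on_def
proof
  fix z assume "z \<in> U"
  from assms[OF this] obtain L where "complex_functional L" "(f has_derivative L) (at z)"
    by (elim exE conjE)
  then show "\<exists>L. complex_functional L \<and> (f has_derivative L) (at z within U)"
    using has_derivative_at_withinI[of f L z U] by metis
qed

lemma holomorphic_fun_onD:
  assumes "holomorphic_fun_on f U" "open U" "z \<in> U"
  shows "(f has_derivative frechet_derivative f (at z)) (at z)"
    and "complex_functional (frechet_derivative f (at z))"
proof -
  have "\<exists>L. complex_functional L \<and> (f has_derivative L) (at z within U)"
    using assms(1,3) by (simp only: holomorphic_fun_on_def)
  then obtain L where L: "complex_functional L" "(f has_derivative L) (at z within U)"
    by (elim exE conjE)
  then have "(f has_derivative L) (at z)"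
    using at_within_open[OF assms(3,2)] by metis
  moreover have "L = frechet_derivative f (at z)"
    by (rule frechet_derivative_at) fact
  ultimately show "(f has_derivative frechet_derivative f (at z)) (at z)"
    "complex_functional (frechet_derivative f (at z))" using L by auto
qed

lemma holomorphic_fun_on_subset:
  "holomorphic_fun_on f U \<Longrightarrow> V \<subseteq> U \<Longrightarrow> holomorphic_fun_on f V"
  unfolding holomorphic_fun_on_def by (meson has_derivative_subset subsetD)

lemma holomorphic_fun_on_imp_continuous_on:
  "holomorphic_fun_on f U \<Longrightarrow> continuous_on U f"
  unfolding holomorphic_fun_on_def continuous_on_eq_continuous_within
  using has_derivative_continuous by blast

lemma holomorphic_fun_on_const: "holomorphic_fun_on (\<lambda>z. c) U"
  by (rule holomorphic_fun_onI, rule exI, rule conjI[OF complex_functionalI has_derivative_const]) auto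

lemma holomorphic_fun_on_add:
  assumes "holomorphic_fun_on f U" "holomorphic_fun_on g U" "open U"
  shows "holomorphic_fun_on (\<lambda>z. f z + g z) U"
proof (rule holomorphic_fun_onI)
  fix z assume z: "z \<in> U"
  note f = holomorphic_fun_onD[OF assms(1,3) z] and g = holomorphic_fun_onD[OF assms(2,3) z]
  note lin = complex_functional_add[OF f(2)] complex_functional_scale[OF f(2)]
    complex_functional_add[OF g(2)] complex_functional_scale[OF g(2)]
  show "\<exists>L. complex_functional L \<and> ((\<lambda>z. f z + g z) has_derivative L) (at z)"
    by (rule exI, rule conjI[OF complex_functionalI has_derivative_add[OF f(1) g(1)]])
       (simp_all only: lin, simp_all add: algebra_simps)
qed

lemma holomorphic_fun_on_mult:
  assumes "holomorphic_fun_on f U" "holomorphic_fun_on g U" "open U"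
  shows "holomorphic_fun_on (\<lambda>z. f z * g z) U"
proof (rule holomorphic_fun_onI)
  fix z assume z: "z \<in> U"
  note f = holomorphic_fun_onD[OF assms(1,3) z] and g = holomorphic_fun_onD[OF assms(2,3) z]
  note lin = complex_functional_add[OF f(2)] complex_functional_scale[OF f(2)]
    complex_functional_add[OF g(2)] complex_functional_scale[OF g(2)]
  show "\<exists>L. complex_functional L \<and> ((\<lambda>z. f z * g z) has_derivative L) (at z)"
    by (rule exI, rule conjI[OF complex_functionalI has_derivative_mult[OF f(1) g(1)]])
       (simp_all only: lin, simp_all add: algebra_simps)
qed

lemma holomorphic_fun_on_sum:
  assumes "\<And>i. i \<in> A \<Longrightarrow> holomorphic_fun_on (f i) U" "open U"
  shows "holomorphic_fun_on (\<lambda>z. \<Sum>i\<in>A. f i z) U"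
  using assms(1)
  by (induction A rule: infinite_finite_induct)
     (auto intro: holomorphic_fun_on_const holomorphic_fun_on_add assms(2))

lemma holomorphic_fun_on_prod:
  assumes "\<And>i. i \<in> A \<Longrightarrow> holomorphic_fun_on (f i) U" "open U"
  shows "holomorphic_fun_on (\<lambda>z. \<Prod>i\<in>A. f i z) U"
  using assms(1)
  by (induction A rule: infinite_finite_induct)
     (auto intro: holomorphic_fun_on_const holomorphic_fun_on_mult assms(2))

lemma holomorphic_fun_on_power:
  assumes "holomorphic_fun_on f U" "open U"
  shows "holomorphic_fun_on (\<lambda>z. f z ^ k) U"
  by (induction k) (auto intro: holomorphic_fun_on_const holomorphic_fun_on_mult assms)

lemma holomorphic_fun_on_det:
  assumes "\<And>i j. holomorphic_fun_on (\<lambda>z. A z i j) U" "open U"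
  shows "holomorphic_fun_on (\<lambda>z. det (\<chi> i j. A z i j)) U"
  unfolding det_def
  by (auto intro!: holomorphic_fun_on_sum holomorphic_fun_on_mult holomorphic_fun_on_prod
      holomorphic_fun_on_const assms)

lemma holomorphic_fun_on_compose:
  assumes f: "holomorphic_fun_on f V" "open V" and gUV: "g ` U \<subseteq> V"
    and g: "\<And>z. z \<in> U \<Longrightarrow> \<exists>L. complex_linear L \<and> (g has_derivative L) (at z)"
  shows "holomorphic_fun_on (\<lambda>z. f (g z)) U"
proof (rule holomorphic_fun_onI)
  fix z assume z: "z \<in> U"
  obtain L where L: "complex_linear L" "(g has_derivative L) (at z)" using g[OF z] by blast
  interpret L: Vector_Spaces.linear "(*s)" "(*s)" L by fact
  have "g z \<in> V" using z gUV by blast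
  note fz = holomorphic_fun_onD[OF f this]
  show "\<exists>L. complex_functional L \<and> ((\<lambda>z. f (g z)) has_derivative L) (at z)"
    by (rule exI, rule conjI[OF complex_functionalI has_derivative_compose[OF L(2) fz(1)]])
       (simp_all only: L.add L.scale complex_functional_add[OF fz(2)] complex_functional_scale[OF fz(2)])
qed

lemma bounded_linear_scalar_line: "bounded_linear (\<lambda>s::complex. s *s (v :: complex ^ 'n))"
  unfolding linear_conv_bounded_linear[symmetric]
  by (rule linearI) (simp_all add: vec_eq_iff algebra_simps)

lemma holomorphic_on_line:
  assumes "holomorphic_fun_on f U" "open U" "p + t *s v \<in> U"
  shows "((\<lambda>s. f (p + s *s v)) has_field_derivative frechet_derivative f (at (p + t *s v)) v) (at t)"
proof -
  note f = holomorphic_fun_onD[OF assms]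
  have "((\<lambda>s. p + s *s v) has_derivative (\<lambda>s. s *s v)) (at t)"
    by (auto intro!: derivative_eq_intros bounded_linear_imp_has_derivative bounded_linear_scalar_line)
  from has_derivative_compose[OF this f(1)]
  have "((\<lambda>s. f (p + s *s v)) has_derivative (\<lambda>s. frechet_derivative f (at (p + t *s v)) (s *s v))) (at t)" .
  then show ?thesis
    by (simp add: has_field_derivative_def complex_functional_scale[OF f(2)] mult_commute_abs)
qed

text \<open>The second estimate is Taylor's theorem with the second derivative bounded on \<open>cball 0 (\<delta> / 2)\<close>
by Cauchy's inequality on discs of radius \<open>\<delta> / 4\<close>: this is where \<open>2 B / (\<delta> / 4)\<^sup>2 = 32 B / \<delta>\<^sup>2\<close> comes from.\<close>

lemma Cauchy_estimates_disc:
  assumes k: "k holomorphic_on ball 0 \<delta>" and B: "\<And>t. t \<in> ball 0 \<delta> \<Longrightarrow> cmod (k t) \<le> B" and "\<delta> > 0"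
  shows "cmod (deriv k 0) \<le> 2 * B / \<delta>"
    and "cmod t \<le> \<delta> / 2 \<Longrightarrow> cmod (k t - k 0 - deriv k 0 * t) \<le> 32 * B / \<delta>\<^sup>2 * (cmod t)\<^sup>2"
proof -
  have Ci: "cmod ((deriv ^^ n) k s) \<le> fact n * B / (\<delta>/4)^n" if "cmod s \<le> \<delta>/2" for n s
  proof (rule Cauchy_inequality)
    have sub: "cball s (\<delta>/4) \<subseteq> ball 0 \<delta>"
      using that \<open>\<delta> > 0\<close> by (auto simp: cball_subset_ball_iff dist_norm)
    show "k holomorphic_on ball s (\<delta>/4)" "continuous_on (cball s (\<delta>/4)) k"
      by (fact holomorphic_on_subset[OF k order_trans[OF ball_subset_cball sub]]
          holomorphic_on_imp_continuous_on[OF holomorphic_on_subset[OF k sub]])+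
    show "cmod (k x) \<le> B" if "cmod (s - x) = \<delta>/4" for x
      using that sub by (intro B) (auto simp: subset_iff dist_norm)
  qed (use \<open>\<delta> > 0\<close> in auto)
  have "cmod ((deriv ^^ 1) k 0) \<le> fact 1 * B / (\<delta>/2)^1"
  proof (rule Cauchy_inequality)
    have sub: "cball 0 (\<delta>/2) \<subseteq> ball (0::complex) \<delta>"
      using \<open>\<delta> > 0\<close> by auto
    show "k holomorphic_on ball 0 (\<delta>/2)" "continuous_on (cball 0 (\<delta>/2)) k"
      by (fact holomorphic_on_subset[OF k order_trans[OF ball_subset_cball sub]]
          holomorphic_on_imp_continuous_on[OF holomorphic_on_subset[OF k sub]])+
    show "cmod (k x) \<le> B" if "cmod (0 - x) = \<delta>/2" for x
      using that sub by (intro B) (auto simp: subset_iff)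
  qed (use \<open>\<delta> > 0\<close> in auto)
  then show "cmod (deriv k 0) \<le> 2 * B / \<delta>" by (simp add: field_simps)
  assume t: "cmod t \<le> \<delta> / 2"
  have "cmod ((deriv ^^ 0) k t - (\<Sum>i\<le>1. (deriv ^^ i) k 0 * (t - 0) ^ i / fact i))
      \<le> 32 * B / \<delta>\<^sup>2 * cmod (t - 0) ^ Suc 1 / fact 1"
  proof (rule complex_Taylor[where S = "cball 0 (\<delta>/2)"])
    show "((deriv ^^ i) k has_field_derivative (deriv ^^ Suc i) k x) (at x within cball 0 (\<delta>/2))"
      if "x \<in> cball 0 (\<delta>/2)" for i x
    proof -
      have "(deriv ^^ i) k holomorphic_on ball 0 \<delta>"
        using k by (rule holomorphic_higher_deriv) auto
      moreover have "x \<in> ball 0 \<delta>" using that \<open>\<delta> > 0\<close> by auto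
      ultimately show ?thesis
        using holomorphic_derivI[OF _ open_ball] by (auto intro: has_field_derivative_at_within)
    qed
    show "cmod ((deriv ^^ Suc 1) k x) \<le> 32 * B / \<delta>\<^sup>2" if "x \<in> cball 0 (\<delta>/2)" for x
      using Ci[of x 2] that by (simp add: field_simps power2_eq_square numeral_2_eq_2)
  qed (use t \<open>\<delta> > 0\<close> in auto)
  then show "cmod (k t - k 0 - deriv k 0 * t) \<le> 32 * B / \<delta>\<^sup>2 * (cmod t)\<^sup>2"
    by (simp add: power2_eq_square algebra_simps)
qed

text \<open>The one-variable estimates on the complex line through \<open>p\<close> in direction \<open>v\<close>.  The second one controls the
error of linearization by constants that depend only on the bound and the radius; this uniformity is
what makes limits of sequences tractable.\<close>

lemma Cauchy_estimates_ball:
  fixes f :: "complex ^ 'n \<Rightarrow> complex"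
  assumes f: "holomorphic_fun_on f (ball p \<delta>)" and B: "\<And>z. z \<in> ball p \<delta> \<Longrightarrow> cmod (f z) \<le> B" and "\<delta> > 0"
  shows "cmod (frechet_derivative f (at p) v) \<le> 2 * B / \<delta> * norm v"
    and "norm v \<le> \<delta> / 2 \<Longrightarrow>
      cmod (f (p + v) - f p - frechet_derivative f (at p) v) \<le> 32 * B / \<delta>\<^sup>2 * (norm v)\<^sup>2"
proof -
  have p: "p \<in> ball p \<delta>" using \<open>\<delta> > 0\<close> by simp
  note lin = holomorphic_fun_onD(2)[OF f open_ball p]
  have "cmod (frechet_derivative f (at p) v) \<le> 2 * B / \<delta> * norm v \<and>
    (norm v \<le> \<delta> / 2 \<longrightarrow> cmod (f (p + v) - f p - frechet_derivative f (at p) v) \<le> 32 * B / \<delta>\<^sup>2 * (norm v)\<^sup>2)"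
  proof (cases "v = 0")
    case True
    have "frechet_derivative f (at p) 0 = 0"
      using complex_functional_scale[OF lin, of 0 0] by simp
    with True show ?thesis by simp
  next
    case False
    define u where "u = (1 / complex_of_real (norm v)) *s v"
    have nu: "norm u = 1" and vu: "v = complex_of_real (norm v) *s u"
      using False by (simp_all add: u_def norm_vector_scalar_mult norm_divide)
    define k where "k = (\<lambda>t. f (p + t *s u))"
    have in_ball: "p + t *s u \<in> ball p \<delta> \<longleftrightarrow> t \<in> ball 0 \<delta>" for t
      by (simp add: dist_norm norm_vector_scalar_mult nu)
    have der: "(k has_field_derivative frechet_derivative f (at (p + t *s u)) u) (at t)"
      if "t \<in> ball 0 \<delta>" for t
      unfolding k_def using that in_ball by (intro holomorphic_on_line[OF f open_ball]) blast
    have hol: "k holomorphic_on ball 0 \<delta>"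
      using der by (meson holomorphic_onI field_differentiable_at_within field_differentiable_def)
    have dk: "deriv k 0 = frechet_derivative f (at p) u"
      using der[of 0] \<open>\<delta> > 0\<close> by (simp add: DERIV_imp_deriv)
    have dv: "frechet_derivative f (at p) v = deriv k 0 * norm v"
      by (subst vu) (simp add: complex_functional_scale[OF lin] dk)
    have kB: "cmod (k t) \<le> B" if "t \<in> ball 0 \<delta>" for t
      unfolding k_def using that in_ball by (intro B) blast
    note est = Cauchy_estimates_disc[OF hol kB \<open>\<delta> > 0\<close>]
    have "k (norm v) = f (p + v)" "k 0 = f p"
      using vu by (simp_all add: k_def)
    with mult_right_mono[OF est(1) norm_ge_zero[of v]] est(2)[of "norm v"] show ?thesis
      by (auto simp: dv norm_mult)
  qed
  then show "cmod (frechet_derivative f (at p) v) \<le> 2 * B / \<delta> * norm v"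
    "norm v \<le> \<delta> / 2 \<Longrightarrow>
      cmod (f (p + v) - f p - frechet_derivative f (at p) v) \<le> 32 * B / \<delta>\<^sup>2 * (norm v)\<^sup>2"
    by auto
qed

text \<open>Pointwise convergence suffices: by the uniform second order estimate the derivatives at \<open>p\<close> form a Cauchy
sequence, as they are uniformly close to difference quotients that converge, and the linearization error
of the limit obeys the same quadratic bound.\<close>

lemma pointwise_limit_derivative:
  fixes f :: "nat \<Rightarrow> complex ^ 'n \<Rightarrow> complex"
  assumes hol: "\<And>n. n \<ge> N \<Longrightarrow> holomorphic_fun_on (f n) (ball p \<delta>)"
    and B: "\<And>n z. n \<ge> N \<Longrightarrow> z \<in> ball p \<delta> \<Longrightarrow> cmod (f n z) \<le> B"
    and lim: "\<And>z. z \<in> ball p \<delta> \<Longrightarrow> (\<lambda>n. f n z) \<longlonglongrightarrow> F z"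
    and "\<delta> > 0"
  shows "(F has_derivative frechet_derivative F (at p)) (at p)" (is ?th1)
    and "complex_functional (frechet_derivative F (at p))" (is ?th2)
    and "(\<lambda>n. frechet_derivative (f n) (at p) v) \<longlonglongrightarrow> frechet_derivative F (at p) v"
proof -
  let ?D = "\<lambda>n. frechet_derivative (f n) (at p)"
  define C where "C = 32 * B / \<delta>\<^sup>2"
  have p: "p \<in> ball p \<delta>" using \<open>\<delta> > 0\<close> by simp
  have "0 \<le> B" using B[of N p] p by (meson norm_ge_zero order_refl order_trans)
  then have C: "C \<ge> 0" by (simp add: C_def)
  note linD = holomorphic_fun_onD(2)[OF hol open_ball p]
  have "convergent (\<lambda>n. ?D n v)" for v
  proof -
    have "Cauchy (\<lambda>n. ?D n v)"
    proof (rule metric_CauchyI)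
      fix e :: real assume "e > 0"
      \<comment> \<open>The difference quotient with step \<open>t\<close> is within \<open>e/4\<close> of the derivative, uniformly in \<open>n\<close>.\<close>
      define t where "t = min (\<delta> / 2 / (norm v + 1)) (e / 4 / (C * (norm v)\<^sup>2 + 1))"
      have "t > 0" using \<open>\<delta> > 0\<close> \<open>e > 0\<close> C
        unfolding t_def by (simp add: add_nonneg_pos)
      have "t \<le> \<delta> / 2 / (norm v + 1)" by (simp add: t_def)
      then have "t * (norm v + 1) \<le> \<delta> / 2"
        by (subst (asm) pos_le_divide_eq) (auto intro: add_nonneg_pos)
      then have tv: "t * norm v \<le> \<delta> / 2" using \<open>t > 0\<close> by (simp add: algebra_simps)
      have "t \<le> e / 4 / (C * (norm v)\<^sup>2 + 1)" by (simp add: t_def)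
      then have "t * (C * (norm v)\<^sup>2 + 1) \<le> e / 4"
        using C by (subst (asm) pos_le_divide_eq) (auto intro: add_nonneg_pos)
      then have tC: "C * t * (norm v)\<^sup>2 \<le> e / 4" using \<open>t > 0\<close> by (simp add: algebra_simps)
      let ?v = "complex_of_real t *s v"
      have nv: "norm ?v = t * norm v" using \<open>t > 0\<close> by (simp add: norm_vector_scalar_mult)
      have "p + ?v \<in> ball p \<delta>"
        using nv tv \<open>\<delta> > 0\<close> by (simp add: dist_norm)
      then have "(\<lambda>n. f n (p + ?v) - f n p) \<longlonglongrightarrow> F (p + ?v) - F p"
        using lim p by (intro tendsto_diff) auto
      then have "Cauchy (\<lambda>n. f n (p + ?v) - f n p)" by (rule LIMSEQ_imp_Cauchy)
      then obtain K where K: "\<And>m n. m \<ge> K \<Longrightarrow> n \<ge> K \<Longrightarrow>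
          dist (f m (p + ?v) - f m p) (f n (p + ?v) - f n p) < t * e / 2"
        using \<open>t > 0\<close> \<open>e > 0\<close> by (meson metric_CauchyD half_gt_zero mult_pos_pos)
      have "dist (?D m v) (?D n v) < e" if "m \<ge> max K N" "n \<ge> max K N" for m n
      proof -
        have est: "cmod (f n (p + ?v) - f n p - t * ?D n v) \<le> t * (e / 4)" if "n \<ge> N" for n
        proof -
          have "cmod (f n (p + ?v) - f n p - ?D n ?v) \<le> C * (norm ?v)\<^sup>2"
            using that nv tv unfolding C_def by (intro Cauchy_estimates_ball(2)[OF hol B \<open>\<delta> > 0\<close>]) auto
          also have "\<dots> = t * (C * t * (norm v)\<^sup>2)" by (simp add: nv power2_eq_square)
          also have "\<dots> \<le> t * (e / 4)" using tC \<open>t > 0\<close> by (intro mult_left_mono) auto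
          finally show ?thesis using complex_functional_scale[OF linD[OF that]] by simp
        qed
        have "cmod (t * ?D m v - t * ?D n v) \<le>
           cmod (f m (p + ?v) - f m p - t * ?D m v) + cmod (f n (p + ?v) - f n p - t * ?D n v)
           + cmod ((f m (p + ?v) - f m p) - (f n (p + ?v) - f n p))"
          by norm
        also have "\<dots> < t * (e / 4) + t * (e / 4) + t * e / 2"
        proof -
          have "cmod ((f m (p + ?v) - f m p) - (f n (p + ?v) - f n p)) < t * e / 2"
            using K[of m n] that by (simp add: dist_norm)
          then show ?thesis
            using add_mono[OF est[of m] est[of n]] that by linarith
        qed
        also have "\<dots> = t * e" by simp
        also have "cmod (t * ?D m v - t * ?D n v) = t * cmod (?D m v - ?D n v)"
          using \<open>t > 0\<close> by (simp add: norm_mult flip: right_diff_distrib)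
        finally show ?thesis using \<open>t > 0\<close> by (simp add: dist_norm)
      qed
      then show "\<exists>M. \<forall>m\<ge>M. \<forall>n\<ge>M. dist (?D m v) (?D n v) < e" by blast
    qed
    then show ?thesis by (simp add: Cauchy_convergent_iff)
  qed
  then obtain L where L: "\<And>v. (\<lambda>n. ?D n v) \<longlonglongrightarrow> L v"
    unfolding convergent_def by metis
  have ev: "eventually (\<lambda>n. n \<ge> N) sequentially" by (rule eventually_ge_at_top)
  have Ladd: "L (x + y) = L x + L y" for x y
  proof (rule LIMSEQ_unique[OF L])
    show "(\<lambda>n. ?D n (x + y)) \<longlonglongrightarrow> L x + L y"
      by (rule Lim_transform_eventually[OF tendsto_add[OF L L]])
         (use ev in eventually_elim, simp add: complex_functional_add[OF linD])
  qed
  have Lscale: "L (c *s x) = c * L x" for c x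
  proof (rule LIMSEQ_unique[OF L])
    show "(\<lambda>n. ?D n (c *s x)) \<longlonglongrightarrow> c * L x"
      by (rule Lim_transform_eventually[OF tendsto_mult_left[OF L]])
         (use ev in eventually_elim, simp add: complex_functional_scale[OF linD])
  qed
  have Lbound: "cmod (L x) \<le> norm x * (2 * B / \<delta>)" for x
    by (rule Lim_bounded[OF tendsto_norm[OF L], of N])
       (use Cauchy_estimates_ball(1)[OF hol B \<open>\<delta> > 0\<close>] in \<open>auto simp: mult.commute\<close>)
  have "bounded_linear L"
    by (rule bounded_linear_intro[OF Ladd _ Lbound]) (simp only: scaleR_eq_vector_scalar_mult Lscale, simp add: scaleR_conv_of_real)
  moreover have rem: "cmod (F (p + v) - F p - L v) \<le> C * (norm v)\<^sup>2" if v: "norm v \<le> \<delta> / 2" for v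
  proof -
    have "p + v \<in> ball p \<delta>" using v \<open>\<delta> > 0\<close> by (simp add: dist_norm)
    then have "(\<lambda>n. cmod (f n (p + v) - f n p - ?D n v)) \<longlonglongrightarrow> cmod (F (p + v) - F p - L v)"
      using lim p L by (intro tendsto_intros) auto
    then show ?thesis
      by (rule Lim_bounded[of _ _ N]) (use Cauchy_estimates_ball(2)[OF hol B \<open>\<delta> > 0\<close> v] in \<open>auto simp: C_def\<close>)
  qed
  moreover have "((\<lambda>v. norm (F (p + v) - F p - L v) / norm v) \<longlongrightarrow> 0) (at 0)"
  proof (rule Lim_null_comparison)
    have "((\<lambda>v::complex ^ 'n. C * norm v) \<longlongrightarrow> C * norm (0 :: complex ^ 'n)) (at 0)"
      by (intro tendsto_intros)
    then show "((\<lambda>v::complex ^ 'n. C * norm v) \<longlongrightarrow> 0) (at 0)" by simp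
    show "\<forall>\<^sub>F v in at 0. norm (norm (F (p + v) - F p - L v) / norm v) \<le> C * norm v"
      unfolding eventually_at
    proof (intro exI[of _ "\<delta> / 2"] conjI ballI impI)
      fix v :: "complex ^ 'n" assume "v \<noteq> 0 \<and> dist v 0 < \<delta> / 2"
      then show "norm (norm (F (p + v) - F p - L v) / norm v) \<le> C * norm v"
        using rem[of v] by (simp add: divide_le_eq power2_eq_square mult.assoc)
    qed (use \<open>\<delta> > 0\<close> in auto)
  qed
  ultimately have FL: "(F has_derivative L) (at p)"
    by (simp add: has_derivative_at)
  then have eq: "L = frechet_derivative F (at p)" by (rule frechet_derivative_at)
  show ?th1 using FL eq by simp
  show ?th2 using eq complex_functionalI[of L, OF Ladd Lscale] by simp
  show "(\<lambda>n. ?D n v) \<longlonglongrightarrow> frechet_derivative F (at p) v" using L[of v] eq by simp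
qed

text \<open>The derivative in direction \<open>v\<close> is the limit of difference quotients.  These are holomorphic, and
the Cauchy estimates bound them near each point, so the limit is holomorphic too.\<close>

lemma holomorphic_fun_on_frechet_derivative:
  fixes f :: "complex ^ 'n \<Rightarrow> complex"
  assumes f: "holomorphic_fun_on f U" and "open U"
  shows "holomorphic_fun_on (\<lambda>z. frechet_derivative f (at z) v) U"
proof (rule holomorphic_fun_onI)
  fix p assume "p \<in> U"
  then obtain e where e: "e > 0" "cball p e \<subseteq> U"
    using \<open>open U\<close> open_contains_cball by blast
  define \<delta> where "\<delta> = e / 3"
  have \<delta>: "\<delta> > 0" using e by (simp add: \<delta>_def)
  have "compact (f ` cball p e)"
    using e f by (intro compact_continuous_image compact_cball)
      (meson continuous_on_subset holomorphic_fun_on_imp_continuous_on)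
  then obtain B where B: "\<And>z. z \<in> cball p e \<Longrightarrow> cmod (f z) \<le> B"
    by (metis compact_imp_bounded bounded_iff imageI)
  have "0 \<le> B" using B[of p] e by (meson centre_in_cball less_imp_le norm_ge_zero order_trans)
  obtain N :: nat where N: "norm v / (\<delta> / 2) \<le> N" using real_arch_simple by blast
  define c where "c = (\<lambda>n::nat. complex_of_real (real (Suc n)))"
  define q where "q = (\<lambda>n z. (f (z + (1 / c n) *s v) - f z) * c n)"
  have c0: "c n \<noteq> 0" "cmod (c n) = real (Suc n)" for n
    by (simp_all add: c_def del: of_nat_Suc)
  have small: "norm ((1 / c n) *s v) \<le> \<delta> / 2" if "n \<ge> N" for n
  proof -
    have "norm v / (\<delta> / 2) \<le> real (Suc n)" using N that by simp
    then show ?thesis using \<delta> c0 by (simp add: norm_vector_scalar_mult norm_divide field_simps)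
  qed
  have sub: "ball z \<delta> \<subseteq> cball p e" if "z \<in> ball p \<delta>" for z
  proof
    fix x assume "x \<in> ball z \<delta>"
    then show "x \<in> cball p e"
      using that dist_triangle[of p x z] e(1) by (auto simp: \<delta>_def)
  qed
  have est: "cmod (q n z - frechet_derivative f (at z) v) \<le> 32 * B / \<delta>\<^sup>2 * (norm v)\<^sup>2 / real (Suc n)"
    "cmod (frechet_derivative f (at z) v) \<le> 2 * B / \<delta> * norm v"
    if z: "z \<in> ball p \<delta>" and n: "n \<ge> N" for n z
  proof -
    have hol: "holomorphic_fun_on f (ball z \<delta>)"
      using f sub[OF z] e by (meson holomorphic_fun_on_subset order_trans)
    have bd: "cmod (f x) \<le> B" if "x \<in> ball z \<delta>" for x
      using B sub[OF z] that by blast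
    note ce = Cauchy_estimates_ball[OF hol bd \<delta>]
    show "cmod (frechet_derivative f (at z) v) \<le> 2 * B / \<delta> * norm v" by (rule ce(1))
    have lin: "complex_functional (frechet_derivative f (at z))"
      using \<delta> by (intro holomorphic_fun_onD[OF hol]) auto
    let ?w = "(1 / c n) *s v"
    have "q n z - frechet_derivative f (at z) v = c n * (f (z + ?w) - f z - frechet_derivative f (at z) ?w)"
      using c0 by (simp add: q_def complex_functional_scale[OF lin] algebra_simps)
    then have "cmod (q n z - frechet_derivative f (at z) v)
        = real (Suc n) * cmod (f (z + ?w) - f z - frechet_derivative f (at z) ?w)"
      using c0 by (simp add: norm_mult)
    also have "\<dots> \<le> real (Suc n) * (32 * B / \<delta>\<^sup>2 * (norm ?w)\<^sup>2)"
      by (intro mult_left_mono ce(2) small[OF n]) auto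
    also have "\<dots> = 32 * B / \<delta>\<^sup>2 * (norm v)\<^sup>2 / real (Suc n)"
      using c0(2)[of n] by (simp add: norm_vector_scalar_mult norm_divide power2_eq_square divide_simps del: of_nat_Suc)
    finally show "cmod (q n z - frechet_derivative f (at z) v) \<le> 32 * B / \<delta>\<^sup>2 * (norm v)\<^sup>2 / real (Suc n)" .
  qed
  let ?B' = "32 * B / \<delta>\<^sup>2 * (norm v)\<^sup>2 + 2 * B / \<delta> * norm v"
  have "holomorphic_fun_on (q n) (ball p \<delta>)" if n: "n \<ge> N" for n
  proof -
    have "holomorphic_fun_on (\<lambda>z. f (z + (1 / c n) *s v)) (ball p \<delta>)"
    proof (rule holomorphic_fun_on_compose[OF f \<open>open U\<close>])
      show "(\<lambda>z. z + (1 / c n) *s v) ` ball p \<delta> \<subseteq> U"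
      proof clarify
        fix z assume z: "z \<in> ball p \<delta>"
        have "dist z (z + (1 / c n) *s v) \<le> \<delta> / 2"
          using small[OF n] by (simp add: dist_norm)
        then have "z + (1 / c n) *s v \<in> ball z \<delta>"
          using \<delta> by simp
        then show "z + (1 / c n) *s v \<in> U"
          using sub[OF z] e by blast
      qed
      have "complex_linear (\<lambda>x :: complex ^ 'n. x)"
        by unfold_locales (auto simp: algebra_simps)
      then show "\<exists>L. complex_linear L \<and> ((\<lambda>z. z + (1 / c n) *s v) has_derivative L) (at z)" for z
        by (intro exI[of _ "\<lambda>x. x"]) (auto intro!: derivative_eq_intros)
    qed
    moreover have "holomorphic_fun_on (\<lambda>z. (-1) * f z) (ball p \<delta>)"
    proof (intro holomorphic_fun_on_mult holomorphic_fun_on_const open_ball)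
      have "ball p \<delta> \<subseteq> U" using e \<delta>_def by force
      then show "holomorphic_fun_on f (ball p \<delta>)" using f holomorphic_fun_on_subset by blast
    qed
    ultimately have "holomorphic_fun_on (\<lambda>z. (f (z + (1 / c n) *s v) + (-1) * f z) * c n) (ball p \<delta>)"
      by (rule holomorphic_fun_on_mult[OF holomorphic_fun_on_add[OF _ _ open_ball] holomorphic_fun_on_const open_ball])
    then show ?thesis by (simp add: q_def)
  qed
  moreover have "cmod (q n z) \<le> ?B'" if "n \<ge> N" "z \<in> ball p \<delta>" for n z
  proof -
    have "cmod (q n z) \<le> cmod (q n z - frechet_derivative f (at z) v) + cmod (frechet_derivative f (at z) v)"
      by norm
    also have "\<dots> \<le> 32 * B / \<delta>\<^sup>2 * (norm v)\<^sup>2 / real (Suc n) + 2 * B / \<delta> * norm v"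
      by (intro add_mono est(1)[OF that(2,1)] est(2)[OF that(2,1)])
    also have "\<dots> \<le> ?B'"
      using \<open>0 \<le> B\<close> divide_left_mono[of 1 "real (Suc n)" "32 * B / \<delta>\<^sup>2 * (norm v)\<^sup>2"]
      by (intro add_right_mono) simp
    finally show ?thesis .
  qed
  moreover have "(\<lambda>n. q n z) \<longlonglongrightarrow> frechet_derivative f (at z) v" if z: "z \<in> ball p \<delta>" for z
  proof -
    have "(\<lambda>n. 32 * B / \<delta>\<^sup>2 * (norm v)\<^sup>2 / real (Suc n)) \<longlonglongrightarrow> 0"
      by (rule LIMSEQ_Suc[OF lim_const_over_n])
    moreover have "\<forall>\<^sub>F n in sequentially. norm (q n z - frechet_derivative f (at z) v)
        \<le> 32 * B / \<delta>\<^sup>2 * (norm v)\<^sup>2 / real (Suc n)"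
      using eventually_ge_at_top[of N] by eventually_elim (rule est(1)[OF z])
    ultimately have "(\<lambda>n. q n z - frechet_derivative f (at z) v) \<longlonglongrightarrow> 0"
      by (rule Lim_null_comparison[rotated])
    then show ?thesis by (simp add: LIM_zero_iff)
  qed
  ultimately show "\<exists>L. complex_functional L \<and> ((\<lambda>z. frechet_derivative f (at z) v) has_derivative L) (at p)"
    using pointwise_limit_derivative(1,2)[of N q p \<delta> ?B' "\<lambda>z. frechet_derivative f (at z) v"] \<delta> by blast
qed

section \<open>Mean values and Jacobians\<close>

lemma holomorphic_circle_mean:
  assumes k: "k holomorphic_on S" and S: "cball 0 1 \<subseteq> S"
  shows "((\<lambda>t. k (exp (2 * of_real pi * \<i> * of_real t))) has_integral k 0) {0..1}"
proof -
  have "((\<lambda>u. k u / (u - 0)) has_contour_integral (2 * of_real pi * \<i> * k 0)) (circlepath 0 1)"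
    by (rule Cauchy_integral_circlepath_simple[OF holomorphic_on_subset[OF k S]]) simp
  then have "((\<lambda>t. k (circlepath 0 1 t) / (circlepath 0 1 t - 0) * vector_derivative (circlepath 0 1) (at t))
      has_integral 2 * of_real pi * \<i> * k 0) {0..1}"
    by (simp only: has_contour_integral)
  also have "(\<lambda>t. k (circlepath 0 1 t) / (circlepath 0 1 t - 0) * vector_derivative (circlepath 0 1) (at t))
      = (\<lambda>t. 2 * of_real pi * \<i> * k (exp (2 * of_real pi * \<i> * of_real t)))"
    unfolding vector_derivative_circlepath by (simp add: fun_eq_iff circlepath)
  finally have "((\<lambda>t. 2 * of_real pi * \<i> * k (exp (2 * of_real pi * \<i> * of_real t)))
      has_integral 2 * of_real pi * \<i> * k 0) {0..1}" .
  from has_integral_mult_right[OF this, of "1 / (2 * of_real pi * \<i>)"] show ?thesis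
    by simp
qed

text \<open>The mean value property of the holomorphic function \<open>k\<^sup>2\<close>, with the modulus taken inside the integral.\<close>

lemma holomorphic_circle_mean_square:
  assumes k: "k holomorphic_on S" and S: "cball 0 1 \<subseteq> S"
  shows "ennreal ((cmod (k 0))\<^sup>2) \<le>
    (\<integral>\<^sup>+t\<in>{0..1}. ennreal ((cmod (k (exp (2 * of_real pi * \<i> * of_real t))))\<^sup>2) \<partial>lborel)"
proof -
  let ?e = "\<lambda>t. exp (2 * of_real pi * \<i> * complex_of_real t)"
  let ?h = "\<lambda>t. (cmod (k (?e t)))\<^sup>2"
  have "continuous_on {0..1} (\<lambda>t. k (?e t))"
  proof (rule continuous_on_compose2[OF holomorphic_on_imp_continuous_on[OF k]])
    show "?e ` {0..1} \<subseteq> S"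
      using S by (auto simp: norm_exp_imaginary intro!: subsetD[OF S])
  qed (intro continuous_intros)
  then have cont: "continuous_on {0..1} ?h"
    by (intro continuous_intros)
  then have int: "set_integrable lborel {0..1} ?h" "?h integrable_on {0..1}"
    by (auto intro: borel_integrable_atLeastAtMost' integrable_continuous_real)
  have sq: "((\<lambda>t. (k (?e t))\<^sup>2) has_integral (k 0)\<^sup>2) {0..1}"
    using k S by (intro holomorphic_circle_mean[of "\<lambda>z. (k z)\<^sup>2" S]) (auto intro!: holomorphic_intros)
  have "(cmod (k 0))\<^sup>2 = norm (integral {0..1} (\<lambda>t. (k (?e t))\<^sup>2))"
    using integral_unique[OF sq] by (simp add: norm_power)
  also have "\<dots> \<le> integral {0..1} ?h"
    using sq int by (intro integral_norm_bound_integral) (auto simp: norm_power has_integral_integrable)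
  also have "\<dots> = (LINT t:{0..1}|lborel. ?h t)"
    using set_borel_integral_eq_integral(2)[OF int(1)] by simp
  finally have "ennreal ((cmod (k 0))\<^sup>2) \<le> ennreal (LINT t:{0..1}|lborel. ?h t)"
    by (rule ennreal_leI)
  also have "\<dots> = (\<integral>\<^sup>+t. ennreal (indicator {0..1} t * ?h t) \<partial>lborel)"
    using int(1) by (subst nn_integral_eq_integral) (auto simp: set_integrable_def set_lebesgue_integral_def)
  also have "\<dots> = (\<integral>\<^sup>+t\<in>{0..1}. ennreal (?h t) \<partial>lborel)"
    by (intro nn_integral_cong) (auto split: split_indicator)
  finally show ?thesis .
qed

lemma borel_measurable_cmod_sq_indicator:
  assumes "continuous_on U f" "open U"
  shows "(\<lambda>z. (cmod (indicator U z *\<^sub>R f z))\<^sup>2) \<in> borel_measurable borel"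
proof -
  have "(\<lambda>z. indicator U z *\<^sub>R f z) \<in> borel_measurable borel"
    using assms by (intro borel_measurable_continuous_on_indicator) auto
  then show ?thesis by measurable
qed

text \<open>Change of variables: the determinant of a scalar of modulus \<open>1\<close> has modulus \<open>1\<close>.\<close>

lemma nn_integral_rotation:
  fixes h :: "complex ^ 'n \<Rightarrow> real"
  assumes w: "cmod w = 1" and h: "h \<in> borel_measurable borel" "\<And>x. 0 \<le> h x"
    and fin: "(\<integral>\<^sup>+z\<in>ball 0 \<rho>. ennreal (h z) \<partial>lborel) < \<infinity>"
  shows "(\<integral>\<^sup>+z\<in>ball 0 \<rho>. ennreal (h (w *s z)) \<partial>lborel) = (\<integral>\<^sup>+z\<in>ball 0 \<rho>. ennreal (h z) \<partial>lborel)"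
proof -
  interpret det_square_like "\<lambda>f :: complex ^ 'n \<Rightarrow> complex ^ 'n. (cmod (det (matrix f)))\<^sup>2"
    by (rule det_square_like_complex_det)
  have w0: "w \<noteq> 0" using w by auto
  have image: "(*s) w ` ball 0 \<rho> = (ball 0 \<rho> :: (complex ^ 'n) set)"
  proof
    show "(ball 0 \<rho> :: (complex ^ 'n) set) \<subseteq> (*s) w ` ball 0 \<rho>"
    proof
      fix z :: "complex ^ 'n" assume "z \<in> ball 0 \<rho>"
      then have "(1 / w) *s z \<in> ball 0 \<rho>" "z = w *s ((1 / w) *s z)"
        using w w0 by (simp_all add: norm_vector_scalar_mult norm_divide)
      then show "z \<in> (*s) w ` ball 0 \<rho>" by blast
    qed
  qed (auto simp: norm_vector_scalar_mult w)
  have lin: "complex_linear ((*s) w :: complex ^ 'n \<Rightarrow> _)"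
    by unfold_locales (auto simp: vec_eq_iff algebra_simps)
  have inj: "inj ((*s) w :: complex ^ 'n \<Rightarrow> _)"
    using w0 by (auto simp: inj_def vec_eq_iff)
  have "(\<integral>\<^sup>+z\<in>ball 0 \<rho>. ennreal ((cmod (det (matrix ((*s) w :: complex ^ 'n \<Rightarrow> _))))\<^sup>2 * h (w *s z)) \<partial>lborel)
      = (\<integral>\<^sup>+z\<in>(*s) w ` ball 0 \<rho>. ennreal (h z) \<partial>lborel)"
  proof (rule nn_integral_change_of_variables_holomorphic)
    show "((*s) w has_derivative (*s) w) (at z)" for z :: "complex ^ 'n"
      using complex_linear_imp_linear[OF lin]
      by (intro bounded_linear_imp_has_derivative) (simp add: linear_conv_bounded_linear)
    show "open ((*s) w ` (ball 0 \<rho> :: (complex ^ 'n) set))" by (simp add: image)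
    show "(\<integral>\<^sup>+z\<in>(*s) w ` ball 0 \<rho>. ennreal (h z) \<partial>lborel) < \<infinity>" using fin by (simp add: image)
    show "inj_on ((*s) w) (ball 0 \<rho> :: (complex ^ 'n) set)" using inj by (auto simp: inj_on_def inj_def)
    show "(\<lambda>z. indicator (ball 0 \<rho>) z *\<^sub>R det (matrix ((*s) w :: complex ^ 'n \<Rightarrow> _)))
        \<in> borel_measurable (borel :: (complex ^ 'n) measure)"
      by (intro borel_measurable_scaleR borel_measurable_indicator) auto
  qed (use h lin inj in auto)
  then show ?thesis
    by (simp add: scalar w image)
qed

text \<open>Averaging over the rotations \<open>z \<mapsto> exp (2 \<pi> \<i> t) z\<close> replaces polar coordinates: on each
circle the mean value property bounds \<open>\<bar>G 0\<bar>\<^sup>2\<close> by the mean of \<open>\<bar>G\<bar>\<^sup>2\<close>, and each rotation preserves the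
integral of \<open>\<bar>G\<bar>\<^sup>2\<close> over the ball.\<close>

lemma mean_value_inequality_ball:
  fixes G :: "complex ^ 'n \<Rightarrow> complex"
  assumes G: "holomorphic_fun_on G (ball 0 \<rho>)"
    and fin: "(\<integral>\<^sup>+z\<in>ball 0 \<rho>. ennreal ((cmod (G z))\<^sup>2) \<partial>lborel) < \<infinity>"
  shows "ennreal ((cmod (G 0))\<^sup>2) * emeasure lborel (ball 0 \<rho> :: (complex ^ 'n) set) \<le>
    (\<integral>\<^sup>+z\<in>ball 0 \<rho>. ennreal ((cmod (G z))\<^sup>2) \<partial>lborel)"
proof -
  let ?B = "ball 0 \<rho> :: (complex ^ 'n) set"
  let ?e = "\<lambda>t. exp (2 * of_real pi * \<i> * complex_of_real t)"
  define h where "h = (\<lambda>z. (cmod (indicator ?B z *\<^sub>R G z))\<^sup>2)"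
  have h: "h \<in> borel_measurable borel"
    unfolding h_def using G by (intro borel_measurable_cmod_sq_indicator holomorphic_fun_on_imp_continuous_on) auto
  have hB: "ennreal (h z) * indicator ?B z = ennreal ((cmod (G z))\<^sup>2) * indicator ?B z" for z
    by (auto simp: h_def split: split_indicator)
  have fin_h: "(\<integral>\<^sup>+z\<in>?B. ennreal (h z) \<partial>lborel) < \<infinity>" using fin by (simp only: hB)
  have point: "ennreal ((cmod (G 0))\<^sup>2) * indicator ?B z \<le> (\<integral>\<^sup>+t\<in>{0..1}. ennreal (h (?e t *s z)) \<partial>lborel) * indicator ?B z" for z
  proof (cases "z \<in> ?B")
    case True
    let ?S = "{s. s *s z \<in> ?B}"
    have "continuous_on UNIV (\<lambda>s. s *s z)"
      by (intro linear_continuous_on bounded_linear_scalar_line)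
    then have openS: "open ?S"
      using open_vimage[OF open_ball, of "\<lambda>s. s *s z" 0 \<rho>] by (simp add: vimage_def)
    have k: "(\<lambda>s. G (0 + s *s z)) holomorphic_on ?S"
    proof (rule holomorphic_onI)
      fix s assume "s \<in> ?S"
      then have "((\<lambda>s. G (0 + s *s z)) has_field_derivative frechet_derivative G (at (0 + s *s z)) z) (at s)"
        by (intro holomorphic_on_line[OF G]) auto
      then show "(\<lambda>s. G (0 + s *s z)) field_differentiable at s within ?S"
        by (meson field_differentiable_at_within field_differentiable_def)
    qed
    have S: "cball 0 1 \<subseteq> ?S"
    proof
      fix s :: complex assume "s \<in> cball 0 1"
      then have "cmod s * norm z \<le> 1 * norm z"
        by (intro mult_right_mono) auto
      with True show "s \<in> ?S" by (simp add: norm_vector_scalar_mult)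
    qed
    have eB: "?e t *s z \<in> ?B" for t
      using True by (simp add: norm_vector_scalar_mult norm_exp_imaginary)
    have "ennreal ((cmod (G 0))\<^sup>2) \<le> (\<integral>\<^sup>+t\<in>{0..1}. ennreal ((cmod (G (?e t *s z)))\<^sup>2) \<partial>lborel)"
      using holomorphic_circle_mean_square[OF k S] by simp
    also have "\<dots> = (\<integral>\<^sup>+t\<in>{0..1}. ennreal (h (?e t *s z)) \<partial>lborel)"
      using eB by (simp add: h_def)
    finally show ?thesis using True by simp
  qed simp
  have meas: "(\<lambda>x. h (?e (fst x) *s snd x)) \<in> borel_measurable (borel :: (real \<times> (complex ^ 'n)) measure)"
  proof (rule measurable_compose[OF _ h])
    have "continuous_on UNIV (\<lambda>x :: real \<times> (complex ^ 'n). \<chi> i. ?e (fst x) * snd x $ i)"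
      by (intro continuous_intros)
    then show "(\<lambda>x :: real \<times> (complex ^ 'n). ?e (fst x) *s snd x) \<in> borel_measurable borel"
      by (intro borel_measurable_continuous_onI) (simp add: vector_scalar_mult_def)
  qed
  have "ennreal ((cmod (G 0))\<^sup>2) * emeasure lborel ?B = (\<integral>\<^sup>+z\<in>?B. ennreal ((cmod (G 0))\<^sup>2) \<partial>lborel)"
    by (simp add: nn_integral_cmult_indicator)
  also have "\<dots> \<le> (\<integral>\<^sup>+z\<in>?B. (\<integral>\<^sup>+t\<in>{0..1}. ennreal (h (?e t *s z)) \<partial>lborel) \<partial>lborel)"
    by (intro nn_integral_mono point)
  also have "\<dots> = (\<integral>\<^sup>+z. (\<integral>\<^sup>+t. ennreal (h (?e t *s z)) * indicator {0..1} t * indicator ?B z \<partial>lborel) \<partial>lborel)"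
    by (intro nn_integral_cong) (auto split: split_indicator)
  also have "\<dots> = (\<integral>\<^sup>+t. (\<integral>\<^sup>+z. ennreal (h (?e t *s z)) * indicator {0..1} t * indicator ?B z \<partial>lborel) \<partial>lborel)"
  proof (rule lborel_pair.Fubini')
    have "(\<lambda>x. ennreal (h (?e (fst x) *s snd x)) * indicator {0..1} (fst x) * indicator ?B (snd x))
        \<in> borel_measurable (lborel :: (real \<times> (complex ^ 'n)) measure)"
    proof -
      have "(\<lambda>x :: real \<times> (complex ^ 'n). indicator {0..1} (fst x) :: ennreal) \<in> borel_measurable borel"
        "(\<lambda>x :: real \<times> (complex ^ 'n). indicator ?B (snd x) :: ennreal) \<in> borel_measurable borel"
        by (auto intro!: measurable_compose[OF borel_measurable_continuous_onI borel_measurable_indicator] continuous_intros)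
      with meas show ?thesis by measurable
    qed
    then show "(\<lambda>(t, z). ennreal (h (?e t *s z)) * indicator {0..1} t * indicator ?B z)
        \<in> borel_measurable (lborel \<Otimes>\<^sub>M lborel)"
      by (simp add: lborel_prod case_prod_unfold)
  qed
  also have "\<dots> = (\<integral>\<^sup>+t. indicator {0..1::real} t * (\<integral>\<^sup>+z\<in>?B. ennreal (h z) \<partial>lborel) \<partial>lborel)"
  proof (rule nn_integral_cong)
    fix t :: real
    have "(\<integral>\<^sup>+z\<in>?B. ennreal (h (?e t *s z)) \<partial>lborel) = (\<integral>\<^sup>+z\<in>?B. ennreal (h z) \<partial>lborel)"
      by (rule nn_integral_rotation[OF _ h _ fin_h]) (auto simp: norm_exp_imaginary h_def)
    then show "(\<integral>\<^sup>+z. ennreal (h (?e t *s z)) * indicator {0..1} t * indicator ?B z \<partial>lborel)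
        = indicator {0..1} t * (\<integral>\<^sup>+z\<in>?B. ennreal (h z) \<partial>lborel)"
      by (cases "t \<in> {0..1}") auto
  qed
  also have "\<dots> = (\<integral>\<^sup>+z\<in>?B. ennreal (h z) \<partial>lborel)"
    by (simp add: nn_integral_multc)
  finally show ?thesis by (simp only: hB)
qed

text \<open>Defined through partial derivatives of the components, so that it makes sense for a map about which
only its components are known to be holomorphic, such as a limit of embeddings.\<close>

definition jacobian :: "(complex ^ 'n \<Rightarrow> complex ^ 'n) \<Rightarrow> complex ^ 'n \<Rightarrow> complex" where
  "jacobian f z = det (\<chi> i j. frechet_derivative (\<lambda>z. f z $ i) (at z) (axis j 1))"

lemma has_derivative_component:
  "(f has_derivative L) (at z) \<Longrightarrow> ((\<lambda>z. f z $ i) has_derivative (\<lambda>v. L v $ i)) (at z)"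
  by (rule bounded_linear.has_derivative[OF bounded_linear_vec_nth])

lemma frechet_derivative_component:
  assumes "(f has_derivative L) (at z)"
  shows "frechet_derivative (\<lambda>z. f z $ i) (at z) v = L v $ i"
  using frechet_derivative_at[OF has_derivative_component[OF assms, of i]] by metis

lemma jacobian_eq_det:
  assumes "(f has_derivative L) (at z)"
  shows "jacobian f z = det (matrix L)"
  by (simp add: jacobian_def matrix_def frechet_derivative_component[OF assms])

lemma holomorphic_fun_on_jacobian:
  assumes "\<And>i. holomorphic_fun_on (\<lambda>z. f z $ i) U" "open U"
  shows "holomorphic_fun_on (jacobian f) U"
  unfolding jacobian_def
  by (intro holomorphic_fun_on_det holomorphic_fun_on_frechet_derivative assms)

lemma holomorphic_fun_on_component:
  assumes "\<And>z. z \<in> U \<Longrightarrow> \<exists>L. complex_linear L \<and> (f has_derivative L) (at z)"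
  shows "holomorphic_fun_on (\<lambda>z. f z $ i) U"
proof (rule holomorphic_fun_onI)
  fix z assume "z \<in> U"
  from assms[OF this] obtain L where L: "complex_linear L" "(f has_derivative L) (at z)"
    by (elim exE conjE)
  interpret L: Vector_Spaces.linear "(*s)" "(*s)" L by fact
  show "\<exists>L. complex_functional L \<and> ((\<lambda>z. f z $ i) has_derivative L) (at z)"
    by (rule exI, rule conjI[OF complex_functionalI has_derivative_component[OF L(2)]])
       (simp_all add: L.add L.scale)
qed

lemma complex_linear_inverse:
  fixes L :: "complex ^ 'n \<Rightarrow> complex ^ 'n"
  assumes L: "complex_linear L" "inj L"
  obtains L' where "complex_linear L'" "inj L'" "L' \<circ> L = id" "L \<circ> L' = id"
proof
  interpret L: Vector_Spaces.linear "(*s)" "(*s)" L by fact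
  have "surj L" by (rule vec.linear_inj_imp_surj[OF L])
  then have LL: "L (inv L x) = x" for x by (rule surj_f_inv_f)
  show "complex_linear (inv L)"
  proof unfold_locales
    show "inv L (x + y) = inv L x + inv L y" for x y
      by (rule injD[OF \<open>inj L\<close>]) (simp add: LL L.add)
    show "inv L (c *s x) = c *s inv L x" for c x
      by (rule injD[OF \<open>inj L\<close>]) (simp add: LL L.scale)
  qed
  show "inj (inv L)" by (metis LL injI)
  show "inv L \<circ> L = id" using \<open>inj L\<close> by simp
  show "L \<circ> inv L = id" by (simp add: fun_eq_iff LL)
qed

lemma holomorphic_embedding_derivative:
  assumes "holomorphic_embedding_on f U" "open U" "z \<in> U"
  obtains L where "complex_linear L" "inj L" "(f has_derivative L) (at z)"
proof -
  have "\<exists>L. complex_linear L \<and> inj L \<and> (f has_derivative L) (at z within U)"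
    using assms(1,3) by (simp only: holomorphic_embedding_on_def)
  then show ?thesis
    using that at_within_open[OF assms(3,2)] by metis
qed

lemma holomorphic_embedding_component:
  assumes "holomorphic_embedding_on f U" "open U"
  shows "holomorphic_fun_on (\<lambda>z. f z $ i) U"
  by (rule holomorphic_fun_on_component) (metis holomorphic_embedding_derivative[OF assms])

lemma holomorphic_embedding_inj_on:
  "holomorphic_embedding_on f U \<Longrightarrow> inj_on f U"
  unfolding holomorphic_embedding_on_def homeomorphism_def by (metis inj_on_inverseI)

lemma holomorphic_embedding_open_image:
  fixes f :: "complex ^ 'n \<Rightarrow> complex ^ 'n"
  assumes "holomorphic_embedding_on f U" "open U" "open V" "V \<subseteq> U"
  shows "open (f ` V)"
proof (rule invariance_of_domain[OF _ assms(3)])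
  have "continuous_on U f"
    using assms(1) unfolding holomorphic_embedding_on_def homeomorphism_def by metis
  then show "continuous_on V f" using assms(4) continuous_on_subset by metis
  show "inj_on f V" using holomorphic_embedding_inj_on[OF assms(1)] assms(4) inj_on_subset by metis
qed

lemma holomorphic_embedding_inverse:
  fixes f :: "complex ^ 'n \<Rightarrow> complex ^ 'n"
  assumes f: "holomorphic_embedding_on f U" "open U"
  obtains g where "\<And>x. x \<in> U \<Longrightarrow> g (f x) = x"
    "\<And>y. y \<in> f ` U \<Longrightarrow> \<exists>L. complex_linear L \<and> inj L \<and> (g has_derivative L) (at y)"
    "\<And>x. x \<in> U \<Longrightarrow> jacobian g (f x) * jacobian f x = 1"
proof -
  obtain g where g: "homeomorphism U (f ` U) f g"
    using f(1) unfolding holomorphic_embedding_on_def by metis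
  then have gf: "g (f x) = x" if "x \<in> U" for x using that by (simp add: homeomorphism_def)
  have contg: "continuous_on (f ` U) g" using g by (simp add: homeomorphism_def)
  have op: "open (f ` U)" by (rule holomorphic_embedding_open_image[OF f f(2) order_refl])
  have der: "\<exists>L L'. complex_linear L \<and> complex_linear L' \<and> inj L' \<and> L' \<circ> L = id
      \<and> (f has_derivative L) (at x) \<and> (g has_derivative L') (at (f x))" if x: "x \<in> U" for x
  proof -
    obtain L where L: "complex_linear L" "inj L" "(f has_derivative L) (at x)"
      using holomorphic_embedding_derivative[OF f x] by metis
    obtain L' where L': "complex_linear L'" "inj L'" "L' \<circ> L = id" "L \<circ> L' = id"
      using complex_linear_inverse[OF L(1,2)] by metis
    have "(g has_derivative L') (at (f x))"
    proof (rule has_derivative_inverse_basic[where T = "f ` U" and f = f])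
      show "(f has_derivative L) (at (g (f x)))" using L(3) gf[OF x] by simp
      show "bounded_linear L'" using complex_linear_imp_linear[OF L'(1)] by (simp add: linear_conv_bounded_linear)
      show "continuous (at (f x)) g"
        using contg op x by (simp add: continuous_on_eq_continuous_at)
    qed (use L' op x gf in auto)
    with L L' show ?thesis by metis
  qed
  have jac: "jacobian g (f x) * jacobian f x = 1" if x: "x \<in> U" for x
  proof -
    obtain L L' where L: "complex_linear L" "complex_linear L'" "L' \<circ> L = id"
      "(f has_derivative L) (at x)" "(g has_derivative L') (at (f x))" using der[OF x] by metis
    have "matrix L' ** matrix L = matrix (L' \<circ> L)"
      using matrix_compose_gen[OF L(1,2)] by simp
    then have "matrix L' ** matrix L = mat 1"
      using L(3) by (simp only: matrix_id_mat_1)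
    then have "det (matrix L') * det (matrix L) = 1"
      by (metis det_mul det_I)
    then show ?thesis by (simp add: jacobian_eq_det[OF L(4)] jacobian_eq_det[OF L(5)])
  qed
  have "\<exists>L. complex_linear L \<and> inj L \<and> (g has_derivative L) (at y)" if "y \<in> f ` U" for y
    using that der by (metis imageE)
  from that[OF gf this jac] show ?thesis .
qed

lemma nn_integral_change_of_variables_embedding:
  fixes g :: "complex ^ 'n \<Rightarrow> complex ^ 'n" and h :: "complex ^ 'n \<Rightarrow> real"
  assumes U: "open U" and gU: "open (g ` U)"
    and g: "\<And>x. x \<in> U \<Longrightarrow> \<exists>L. complex_linear L \<and> inj L \<and> (g has_derivative L) (at x)"
    and inj: "inj_on g U"
    and h: "h \<in> borel_measurable borel" "\<And>x. 0 \<le> h x"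
    and fin: "(\<integral>\<^sup>+x\<in>g ` U. ennreal (h x) \<partial>lborel) < \<infinity>"
  shows "(\<integral>\<^sup>+x\<in>U. ennreal ((cmod (jacobian g x))\<^sup>2 * h (g x)) \<partial>lborel) =
    (\<integral>\<^sup>+x\<in>g ` U. ennreal (h x) \<partial>lborel)"
proof -
  obtain g' where g': "\<And>x. x \<in> U \<Longrightarrow> complex_linear (g' x) \<and> inj (g' x) \<and> (g has_derivative g' x) (at x)"
    using g by metis
  then have jac: "jacobian g x = det (matrix (g' x))" if "x \<in> U" for x
    using that jacobian_eq_det by blast
  have comp: "holomorphic_fun_on (\<lambda>z. g z $ i) U" for i
    using g by (intro holomorphic_fun_on_component) blast
  have "(\<integral>\<^sup>+x\<in>U. ennreal ((cmod (det (matrix (g' x))))\<^sup>2 * h (g x)) \<partial>lborel) =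
    (\<integral>\<^sup>+x\<in>g ` U. ennreal (h x) \<partial>lborel)"
  proof (rule nn_integral_change_of_variables_holomorphic[OF U gU _ _ inj h fin])
    have "(\<lambda>x. indicator U x *\<^sub>R jacobian g x) \<in> borel_measurable borel"
      using U by (intro borel_measurable_continuous_on_indicator holomorphic_fun_on_imp_continuous_on
          holomorphic_fun_on_jacobian comp) auto
    also have "(\<lambda>x. indicator U x *\<^sub>R jacobian g x) = (\<lambda>x. indicator U x *\<^sub>R det (matrix (g' x)))"
      using jac by (auto simp: indicator_def fun_eq_iff)
    finally show "(\<lambda>x. indicator U x *\<^sub>R det (matrix (g' x))) \<in> borel_measurable borel" .
  qed (use g' in auto)
  also have "(\<integral>\<^sup>+x\<in>U. ennreal ((cmod (det (matrix (g' x))))\<^sup>2 * h (g x)) \<partial>lborel) =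
      (\<integral>\<^sup>+x\<in>U. ennreal ((cmod (jacobian g x))\<^sup>2 * h (g x)) \<partial>lborel)"
    using jac by (intro nn_integral_cong) (auto simp: indicator_def)
  finally show ?thesis .
qed

text \<open>The mean value inequality for the pull-back of \<open>F\<close> to the ball under the inverse of \<open>f\<close>, multiplied
by the Jacobian of the inverse.  The Jacobian makes the pull-back an \<open>L\<^sup>2\<close> isometry onto its range, and at the
centre of the ball it is the reciprocal of \<open>jacobian f p\<close>.\<close>

lemma point_estimate_by_embedding:
  fixes f :: "complex ^ 'n \<Rightarrow> complex ^ 'n"
  assumes f: "holomorphic_embedding_on f U" "open U" and p: "p \<in> U" "f p = 0"
    and ball: "ball 0 \<rho> \<subseteq> f ` U" "\<rho> > 0"
    and F: "holomorphic_fun_on F U"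
    and fin: "(\<integral>\<^sup>+z\<in>U. ennreal ((cmod (F z))\<^sup>2) \<partial>lborel) < \<infinity>"
  shows "ennreal ((cmod (F p))\<^sup>2) * emeasure lborel (ball 0 \<rho> :: (complex ^ 'n) set) \<le>
    ennreal ((cmod (jacobian f p))\<^sup>2) * (\<integral>\<^sup>+z\<in>U. ennreal ((cmod (F z))\<^sup>2) \<partial>lborel)"
proof -
  let ?B = "ball 0 \<rho> :: (complex ^ 'n) set"
  obtain g where gf: "\<And>x. x \<in> U \<Longrightarrow> g (f x) = x"
    and g: "\<And>y. y \<in> f ` U \<Longrightarrow> \<exists>L. complex_linear L \<and> inj L \<and> (g has_derivative L) (at y)"
    and jac: "\<And>x. x \<in> U \<Longrightarrow> jacobian g (f x) * jacobian f x = 1"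
    using holomorphic_embedding_inverse[OF f] by metis
  have gU: "g ` ?B \<subseteq> U" and inj: "inj_on g ?B"
    using ball(1) gf by (auto simp: inj_on_def subset_iff image_iff) metis+
  have gB: "\<exists>L. complex_linear L \<and> inj L \<and> (g has_derivative L) (at y)" if "y \<in> ?B" for y
    using g that ball(1) by blast
  have comp: "holomorphic_fun_on (\<lambda>z. g z $ i) ?B" for i
    using gB by (intro holomorphic_fun_on_component) blast
  have op: "open (g ` ?B)"
  proof (rule invariance_of_domain[OF _ open_ball inj])
    show "continuous_on ?B g"
      using gB by (meson continuous_at_imp_continuous_on has_derivative_continuous)
  qed
  define h where "h = (\<lambda>z. (cmod (indicator U z *\<^sub>R F z))\<^sup>2)"
  have h: "h \<in> borel_measurable borel" "\<And>z. 0 \<le> h z"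
    unfolding h_def
    by (rule borel_measurable_cmod_sq_indicator[OF holomorphic_fun_on_imp_continuous_on[OF F] f(2)]) simp
  have le: "(\<integral>\<^sup>+z\<in>g ` ?B. ennreal (h z) \<partial>lborel) \<le> (\<integral>\<^sup>+z\<in>U. ennreal ((cmod (F z))\<^sup>2) \<partial>lborel)"
    using gU by (intro nn_integral_mono) (auto simp: h_def split: split_indicator)
  define G where "G = (\<lambda>y. F (g y) * jacobian g y)"
  have "holomorphic_fun_on G ?B"
    unfolding G_def
  proof (intro holomorphic_fun_on_mult holomorphic_fun_on_jacobian comp open_ball)
    show "holomorphic_fun_on (\<lambda>y. F (g y)) ?B"
      using gB by (intro holomorphic_fun_on_compose[OF F f(2) gU]) blast
  qed
  moreover have "(\<integral>\<^sup>+y\<in>?B. ennreal ((cmod (G y))\<^sup>2) \<partial>lborel) = (\<integral>\<^sup>+z\<in>g ` ?B. ennreal (h z) \<partial>lborel)"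
  proof -
    have "(\<integral>\<^sup>+y\<in>?B. ennreal ((cmod (G y))\<^sup>2) \<partial>lborel) = (\<integral>\<^sup>+y\<in>?B. ennreal ((cmod (jacobian g y))\<^sup>2 * h (g y)) \<partial>lborel)"
      using gU by (intro nn_integral_cong)
        (auto simp: G_def h_def norm_mult power_mult_distrib mult.commute subset_iff split: split_indicator)
    also have "\<dots> = (\<integral>\<^sup>+z\<in>g ` ?B. ennreal (h z) \<partial>lborel)"
      using fin le by (intro nn_integral_change_of_variables_embedding open_ball op gB inj h) auto
    finally show ?thesis .
  qed
  ultimately have "ennreal ((cmod (G 0))\<^sup>2) * emeasure lborel ?B \<le> (\<integral>\<^sup>+z\<in>U. ennreal ((cmod (F z))\<^sup>2) \<partial>lborel)"
    using order_trans[OF mean_value_inequality_ball[of G \<rho>] _] le_less_trans[OF le fin] le by simp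
  then have "ennreal ((cmod (jacobian f p))\<^sup>2) * (ennreal ((cmod (G 0))\<^sup>2) * emeasure lborel ?B) \<le>
      ennreal ((cmod (jacobian f p))\<^sup>2) * (\<integral>\<^sup>+z\<in>U. ennreal ((cmod (F z))\<^sup>2) \<partial>lborel)"
    by (rule mult_left_mono) simp
  moreover have "(cmod (jacobian f p))\<^sup>2 * (cmod (G 0))\<^sup>2 = (cmod (F p))\<^sup>2"
  proof -
    have "g 0 = p" using gf[OF p(1)] p(2) by simp
    then have "jacobian f p * G 0 = F p * (jacobian g (f p) * jacobian f p)"
      using p(2) by (simp add: G_def)
    then have "F p = jacobian f p * G 0"
      using jac[OF p(1)] by simp
    then show ?thesis by (simp add: norm_mult power_mult_distrib)
  qed
  then have "ennreal ((cmod (jacobian f p))\<^sup>2) * ennreal ((cmod (G 0))\<^sup>2) = ennreal ((cmod (F p))\<^sup>2)"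
    by (simp flip: ennreal_mult')
  ultimately show ?thesis by (simp add: mult.assoc[symmetric])
qed

text \<open>The integral is the volume of \<open>f ` U\<close>.\<close>

lemma nn_integral_jacobian_embedding:
  fixes f :: "complex ^ 'n \<Rightarrow> complex ^ 'n"
  assumes f: "holomorphic_embedding_on f U" "open U" and sub: "f ` U \<subseteq> ball 0 1"
  shows "(\<integral>\<^sup>+z\<in>U. ennreal ((cmod (jacobian f z))\<^sup>2) \<partial>lborel) \<le> emeasure lborel (ball 0 1 :: (complex ^ 'n) set)"
proof -
  have op: "open (f ` U)" by (rule holomorphic_embedding_open_image[OF f f(2) order_refl])
  have le: "emeasure lborel (f ` U) \<le> emeasure lborel (ball 0 1 :: (complex ^ 'n) set)"
    using sub by (intro emeasure_mono) auto
  have eq: "(\<integral>\<^sup>+z\<in>f ` U. ennreal 1 \<partial>lborel) = emeasure lborel (f ` U)"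
    using op by simp
  have fin: "(\<integral>\<^sup>+z\<in>f ` U. ennreal 1 \<partial>lborel) < \<infinity>"
    unfolding eq using le emeasure_bounded_finite[of "ball 0 1 :: (complex ^ 'n) set"] by auto
  have "(\<integral>\<^sup>+z\<in>U. ennreal ((cmod (jacobian f z))\<^sup>2 * 1) \<partial>lborel) = (\<integral>\<^sup>+z\<in>f ` U. ennreal 1 \<partial>lborel)"
  proof (rule nn_integral_change_of_variables_embedding[OF f(2) op _ _ _ _ fin])
    show "\<exists>L. complex_linear L \<and> inj L \<and> (f has_derivative L) (at x)" if "x \<in> U" for x
      using holomorphic_embedding_derivative[OF f that] by metis
  qed (auto intro: holomorphic_embedding_inj_on f)
  with eq le show ?thesis by simp
qed

section \<open>Limits of embeddings\<close>

text \<open>Montel's theorem for maps that are controlled near each point only from some index on.  A diagonal argument gives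
convergence on a countable dense set, and the Cauchy estimates make the maps uniformly Lipschitz
near each point, which spreads convergence to all of \<open>M\<close>.\<close>

lemma montel_subsequence:
  fixes f :: "nat \<Rightarrow> complex ^ 'n \<Rightarrow> complex ^ 'm"
  assumes loc: "\<And>p. p \<in> M \<Longrightarrow> \<exists>\<delta>>0. \<exists>N. \<forall>n\<ge>N. (\<forall>z\<in>ball p \<delta>. norm (f n z) \<le> 1) \<and>
      (\<forall>i. holomorphic_fun_on (\<lambda>z. f n z $ i) (ball p \<delta>))"
  obtains k F where "strict_mono k" "\<And>z i. z \<in> M \<Longrightarrow> (\<lambda>n. f (k n) z $ i) \<longlonglongrightarrow> F z i"
proof -
  obtain D :: "(complex ^ 'n) set" where D: "countable D" "\<And>X. open X \<Longrightarrow> X \<noteq> {} \<Longrightarrow> \<exists>d\<in>D. d \<in> X"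
    using countable_dense_setE by blast
  \<comment> \<open>Truncation gives a bound that is valid for all indices; near a given point it eventually changes nothing.\<close>
  define f' where "f' = (\<lambda>n z. if norm (f n z) \<le> 1 then f n z else 0)"
  have "norm (f' n z) \<le> 1" for n z by (simp add: f'_def)
  then obtain k where k: "strict_mono k" and conv: "\<And>z. z \<in> D \<Longrightarrow> \<exists>l. (\<lambda>n. f' (k n) z) \<longlonglongrightarrow> l"
    using function_convergent_subsequence[OF D(1), of f' 1] by metis
  have "convergent (\<lambda>n. f (k n) z $ i)" if "z \<in> M" for z i
  proof -
    from loc[OF that] obtain \<delta> N where "\<delta> > 0"
      and N: "\<And>n x. n \<ge> N \<Longrightarrow> x \<in> ball z \<delta> \<Longrightarrow> norm (f n x) \<le> 1"
      and hol: "\<And>n i. n \<ge> N \<Longrightarrow> holomorphic_fun_on (\<lambda>z. f n z $ i) (ball z \<delta>)" by metis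
    have Lip: "cmod (f n (z + v) $ i - f n z $ i) \<le> 18 / \<delta> * norm v" if n: "n \<ge> N" and v: "norm v \<le> \<delta> / 2" for n v
    proof -
      let ?D = "frechet_derivative (\<lambda>z. f n z $ i) (at z) v"
      have bd: "cmod (f n x $ i) \<le> 1" if "x \<in> ball z \<delta>" for x
        using N[OF n that] Finite_Cartesian_Product.norm_nth_le[of "f n x" i] by linarith
      note est = Cauchy_estimates_ball[of "\<lambda>z. f n z $ i", OF hol[OF n] bd \<open>\<delta> > 0\<close>]
      have D1: "cmod ?D \<le> 2 * 1 / \<delta> * norm v" by (rule est(1))
      have D2: "cmod (f n (z + v) $ i - f n z $ i - ?D) \<le> 32 * 1 / \<delta>\<^sup>2 * (norm v)\<^sup>2"
        by (rule est(2)[OF _ v])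
      have "32 * 1 / \<delta>\<^sup>2 * (norm v)\<^sup>2 = 32 / \<delta>\<^sup>2 * norm v * norm v" by (simp add: power2_eq_square)
      also have "\<dots> \<le> 32 / \<delta>\<^sup>2 * norm v * (\<delta> / 2)"
        using v by (intro mult_left_mono) auto
      also have "\<dots> = 16 / \<delta> * norm v" using \<open>\<delta> > 0\<close> by (simp add: power2_eq_square)
      finally have "cmod (f n (z + v) $ i - f n z $ i - ?D) \<le> 16 / \<delta> * norm v"
        using D2 by linarith
      moreover have "cmod ?D \<le> 2 / \<delta> * norm v" using D1 by simp
      moreover have "cmod (f n (z + v) $ i - f n z $ i) \<le> cmod (f n (z + v) $ i - f n z $ i - ?D) + cmod ?D"
        by norm
      moreover have "16 / \<delta> * norm v + 2 / \<delta> * norm v = 18 / \<delta> * norm v"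
        by (simp add: distrib_right[symmetric] add_divide_distrib[symmetric])
      ultimately show ?thesis by linarith
    qed
    have "Cauchy (\<lambda>n. f (k n) z $ i)"
    proof (rule metric_CauchyI)
      fix e :: real assume "e > 0"
      define t where "t = min (\<delta> / 2) (e * \<delta> / 54)"
      have t: "t > 0" "t \<le> \<delta> / 2" "18 / \<delta> * t \<le> e / 3"
        using \<open>e > 0\<close> \<open>\<delta> > 0\<close> by (auto simp: t_def min_def field_simps)
      then obtain d where d: "d \<in> D" "d \<in> ball z t"
        using D(2)[of "ball z t"] by auto
      have nv: "norm (d - z) < t" using d(2) by (simp add: dist_norm norm_minus_commute)
      have dz: "d \<in> ball z \<delta>" using nv t(1,2) by (simp add: dist_norm norm_minus_commute)
      have diff: "cmod (f n d $ i - f n z $ i) \<le> e / 3" if "n \<ge> N" for n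
      proof -
        have "cmod (f n (z + (d - z)) $ i - f n z $ i) \<le> 18 / \<delta> * norm (d - z)"
          using nv t by (intro Lip that) auto
        also have "\<dots> \<le> 18 / \<delta> * t" using nv \<open>\<delta> > 0\<close> by (intro mult_left_mono) auto
        finally show ?thesis using t(3) by simp
      qed
      obtain l where "(\<lambda>n. f' (k n) d) \<longlonglongrightarrow> l" using conv[OF d(1)] by blast
      then have "Cauchy (\<lambda>n. f' (k n) d)" by (rule LIMSEQ_imp_Cauchy)
      then obtain K where K: "\<And>m n. m \<ge> K \<Longrightarrow> n \<ge> K \<Longrightarrow> dist (f' (k m) d) (f' (k n) d) < e / 3"
        using \<open>e > 0\<close> by (metis metric_CauchyD divide_pos_pos zero_less_numeral)
      have "dist (f (k m) z $ i) (f (k n) z $ i) < e" if mn: "m \<ge> max K N" "n \<ge> max K N" for m n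
      proof -
        have kN: "k m \<ge> N" "k n \<ge> N"
          using mn seq_suble[OF k, of m] seq_suble[OF k, of n] by auto
        then have "f' (k m) d = f (k m) d" "f' (k n) d = f (k n) d"
          using N dz by (auto simp: f'_def)
        then have "norm (f (k m) d - f (k n) d) < e / 3"
          using K[of m n] mn by (simp add: dist_norm)
        then have 1: "cmod (f (k m) d $ i - f (k n) d $ i) < e / 3"
          using Finite_Cartesian_Product.norm_nth_le[of "f (k m) d - f (k n) d" i] by simp
        have "cmod (f (k m) z $ i - f (k n) z $ i) \<le> cmod (f (k m) d $ i - f (k n) d $ i)
            + cmod (f (k m) d $ i - f (k m) z $ i) + cmod (f (k n) d $ i - f (k n) z $ i)"
          by norm
        then show ?thesis using 1 diff[OF kN(1)] diff[OF kN(2)] by (simp add: dist_norm)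
      qed
      then show "\<exists>M. \<forall>m\<ge>M. \<forall>n\<ge>M. dist (f (k m) z $ i) (f (k n) z $ i) < e" by blast
    qed
    then show ?thesis by (simp add: Cauchy_convergent_iff)
  qed
  then have "\<exists>F. \<forall>z i. z \<in> M \<longrightarrow> (\<lambda>n. f (k n) z $ i) \<longlonglongrightarrow> F z i"
    unfolding convergent_def by metis
  with that k show ?thesis by metis
qed

text \<open>Independence is assumed in the form that a vanishing finite combination has vanishing coefficients, which
covers injectivity of \<open>h\<close> as well.\<close>

lemma complex_dimension_infinite:
  fixes h :: "nat \<Rightarrow> 'a \<Rightarrow> complex"
  assumes V: "\<And>k. h k \<in> V"
    and indep: "\<And>m a. (\<And>z. (\<Sum>k<m. a k * h k z) = 0) \<Longrightarrow> \<forall>k<m. a k = 0"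
  shows "complex_dimension V = \<infinity>"
proof -
  have inj: "inj h"
  proof (rule linorder_injI)
    fix i j :: nat assume "i < j"
    show "h i \<noteq> h j"
    proof
      assume eq: "h i = h j"
      let ?a = "\<lambda>k. if k = i then 1 else if k = j then - 1 else 0 :: complex"
      have "(\<Sum>k<Suc j. ?a k * h k z) = (\<Sum>k\<in>{i, j}. ?a k * h k z)" for z
        using \<open>i < j\<close> by (intro sum.mono_neutral_right) auto
      then have "(\<Sum>k<Suc j. ?a k * h k z) = 0" for z
        using eq \<open>i < j\<close> by simp
      from indep[where m = "Suc j" and a = ?a, OF this] have "?a i = 0" using \<open>i < j\<close> by (metis less_SucI)
      then show False by simp
    qed
  qed
  have "\<not> (finite B \<and> V \<subseteq> cfun.span B)" for B
  proof
    assume B: "finite B \<and> V \<subseteq> cfun.span B"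
    have "cfun.independent (range h)"
      unfolding cfun.independent_explicit_module
    proof (intro allI impI)
      fix t u v
      assume t: "finite t" "t \<subseteq> range h" and 0: "(\<Sum>v\<in>t. (\<lambda>x. u v * v x)) = 0" and v: "v \<in> t"
      obtain I where I: "finite I" "t = h ` I" by (metis t finite_subset_image)
      obtain j where j: "j \<in> I" "v = h j" using v I by blast
      obtain m where m: "I \<subseteq> {..<m}" using I(1) finite_nat_iff_bounded by blast
      let ?a = "\<lambda>k. if k \<in> I then u (h k) else 0"
      have "(\<Sum>k<m. ?a k * h k z) = 0" for z
      proof -
        have "(\<Sum>k<m. ?a k * h k z) = (\<Sum>k\<in>I. u (h k) * h k z)"
          using m by (intro sum.mono_neutral_cong_right) auto
        also have "\<dots> = (\<Sum>v\<in>t. u v * v z)"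
          unfolding I(2) using inj by (subst sum.reindex) (auto intro: inj_on_subset)
        also have "\<dots> = (\<Sum>v\<in>t. (\<lambda>x. u v * v x)) z"
          by (induction t rule: infinite_finite_induct) auto
        also have "\<dots> = 0" using 0 by simp
        finally show ?thesis .
      qed
      from indep[where m = m and a = ?a, OF this] have "?a j = 0" using m j by blast
      then show "u v = 0" using j by simp
    qed
    then have "finite (range h)"
      using B V cfun.independent_span_bound[of B "range h"] by blast
    with inj show False using finite_imageD infinite_UNIV_nat by blast
  qed
  then have "\<not> (\<exists>B. finite B \<and> V \<subseteq> cfun.span B)" by blast
  then show ?thesis by (simp only: complex_dimension_def if_False)
qed

text \<open>Near \<open>p\<close> one can divide by \<open>J\<close>, so a linear relation says that the values of \<open>u\<close> are roots of one
polynomial.  If that polynomial is not zero, \<open>u\<close> takes finitely many values on a disc through \<open>p\<close> in direction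
\<open>v\<close>, is constant there by connectedness, and has derivative \<open>0\<close>.\<close>

lemma powers_times_jacobian_independent:
  fixes J u :: "complex ^ 'n \<Rightarrow> complex"
  assumes J: "holomorphic_fun_on J M" and u: "holomorphic_fun_on u M" and M: "open M" "p \<in> M"
    and Jp: "J p \<noteq> 0" and up: "frechet_derivative u (at p) v \<noteq> 0"
    and zero: "\<And>z. z \<in> M \<Longrightarrow> (\<Sum>k<m. a k * (J z * u z ^ k)) = 0"
  shows "\<forall>k<m. a k = 0"
proof (rule ccontr)
  assume "\<not> (\<forall>k<m. a k = 0)"
  then obtain j where j: "j < m" "a j \<noteq> 0" by blast
  have "continuous (at p) J"
    using holomorphic_fun_onD(1)[OF J M] has_derivative_continuous by metis
  then have "\<forall>\<^sub>F z in at p. J z \<noteq> 0"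
    using Jp by (simp add: continuous_at tendsto_imp_eventually_ne)
  then have "\<forall>\<^sub>F z in nhds p. J z \<noteq> 0"
    using Jp unfolding eventually_at_filter by (auto elim: eventually_mono)
  then have "\<forall>\<^sub>F z in nhds p. J z \<noteq> 0 \<and> z \<in> M"
    using eventually_nhds_in_open[OF M] by (rule eventually_conj)
  then obtain W where W: "open W" "p \<in> W" "\<And>z. z \<in> W \<Longrightarrow> J z \<noteq> 0 \<and> z \<in> M"
    unfolding eventually_nhds by blast
  define g where "g = (\<lambda>t. u (p + t *s v))"
  have "continuous_on UNIV (\<lambda>t. p + t *s v)"
    by (intro continuous_intros linear_continuous_on bounded_linear_scalar_line)
  then have "open ((\<lambda>t. p + t *s v) -` W)" by (rule open_vimage[OF W(1)])
  moreover have "0 \<in> (\<lambda>t. p + t *s v) -` W" using W(2) by simp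
  ultimately obtain \<epsilon> where \<epsilon>: "\<epsilon> > 0" "ball 0 \<epsilon> \<subseteq> (\<lambda>t. p + t *s v) -` W"
    by (meson openE)
  have der: "(g has_field_derivative frechet_derivative u (at (p + t *s v)) v) (at t)" if "t \<in> ball 0 \<epsilon>" for t
    unfolding g_def using \<epsilon> that W(3) by (intro holomorphic_on_line[OF u M(1)]) blast
  define P where "P = (\<Sum>k<m. monom (a k) k)"
  have coeffP: "coeff P k = (if k < m then a k else 0)" for k
    by (simp add: P_def coeff_sum coeff_monom)
  have "P \<noteq> 0" using j coeffP[of j] by auto
  have root: "poly P (g t) = 0" if "t \<in> ball 0 \<epsilon>" for t
  proof -
    have "p + t *s v \<in> W" using that \<epsilon> by blast
    then have "J (p + t *s v) * poly P (g t) = 0" "J (p + t *s v) \<noteq> 0"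
      using zero[of "p + t *s v"] W(3)
      by (auto simp: P_def poly_sum poly_monom g_def sum_distrib_left mult_ac)
    then show ?thesis by simp
  qed
  have "finite (g ` ball 0 \<epsilon>)"
    by (rule finite_subset[OF _ poly_roots_finite[OF \<open>P \<noteq> 0\<close>]]) (use root in auto)
  moreover have "connected (g ` ball 0 \<epsilon>)"
    using der by (intro connected_continuous_image connected_ball)
      (meson continuous_at_imp_continuous_on DERIV_isCont)
  ultimately have "\<exists>c. g ` ball 0 \<epsilon> \<subseteq> {c}"
    using connected_finite_iff_sing[of "g ` ball 0 \<epsilon>"] \<epsilon>(1) by auto
  then obtain c where c: "\<And>t. t \<in> ball 0 \<epsilon> \<Longrightarrow> g t = c" by blast
  have "(g has_field_derivative 0) (at 0)"
    by (rule has_field_derivative_transform_within_open[of "\<lambda>_. c" _ _ "ball 0 \<epsilon>"]) (use \<epsilon> c in auto)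
  moreover have "(g has_field_derivative frechet_derivative u (at p) v) (at 0)"
    using der[of 0] \<epsilon> by simp
  ultimately show False using up DERIV_unique by blast
qed

text \<open>Along a subsequence with \<open>\<bar>jacobian (f n) p\<bar>\<close> bounded below, Montel's theorem gives a limit map whose
Jacobian \<open>J\<close> does not vanish at \<open>p\<close>.  Each \<open>f n\<close> is injective into the unit ball, so its squared Jacobian has
integral at most the volume of the ball, and Fatou's lemma carries this to \<open>J\<close>.  The components of the
limit are bounded by \<open>1\<close>, so \<open>J\<close> times any power of a component is square integrable.\<close>

lemma bergman_space_infinite_dimensional:
  fixes A :: "nat \<Rightarrow> (complex ^ 'n) set" and f :: "nat \<Rightarrow> complex ^ 'n \<Rightarrow> complex ^ 'n"
  assumes A: "\<And>n. open (A n)" "incseq A" and M: "M = (\<Union>n. A n)"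
    and f: "\<And>n. n \<ge> n0 \<Longrightarrow> holomorphic_embedding_on (f n) (A n)" "\<And>n. n \<ge> n0 \<Longrightarrow> f n ` A n \<subseteq> ball 0 1"
    and p: "p \<in> M" and nonzero: "\<not> (\<lambda>n. jacobian (f n) p) \<longlonglongrightarrow> 0"
  shows "complex_dimension (bergman_space M) = \<infinity>"
proof -
  have openM: "open M" using A(1) by (auto simp: M)
  obtain e where e: "e > 0" "\<And>N. \<exists>n\<ge>N. cmod (jacobian (f n) p) \<ge> e"
    using nonzero unfolding lim_sequentially dist_norm by (metis diff_zero not_less)
  have "infinite {n. cmod (jacobian (f n) p) \<ge> e}"
    unfolding infinite_nat_iff_unbounded_le using e(2) by blast
  then obtain s :: "nat \<Rightarrow> nat" where s: "strict_mono s" "\<And>n. cmod (jacobian (f (s n)) p) \<ge> e"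
    using infinite_enumerate by blast
  have near: "\<exists>\<delta>>0. \<exists>N\<ge>n0. \<forall>n\<ge>N. ball q \<delta> \<subseteq> A n" if q: "q \<in> M" for q
  proof -
    obtain m where m: "q \<in> A m" using q M by blast
    then obtain \<delta> where "\<delta> > 0" "ball q \<delta> \<subseteq> A m" using A(1) openE by blast
    moreover have "A m \<subseteq> A n" if "n \<ge> max m n0" for n using A(2) that by (simp add: incseq_def)
    ultimately show ?thesis by (meson max.cobounded2 order_trans)
  qed
  have comp: "holomorphic_fun_on (\<lambda>z. f n z $ i) (A n)" if "n \<ge> n0" for n i
    by (rule holomorphic_embedding_component[OF f(1)[OF that] A(1)])
  have le1: "norm (f n z) \<le> 1" if "n \<ge> n0" "z \<in> A n" for n z
    using f(2)[OF that(1)] that(2) by (auto simp: image_subset_iff less_imp_le)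
  have sn: "s n \<ge> n" for n using seq_suble[OF s(1)] .
  obtain k F where k: "strict_mono k" and F: "\<And>z i. z \<in> M \<Longrightarrow> (\<lambda>n. f (s (k n)) z $ i) \<longlonglongrightarrow> F z i"
  proof (rule montel_subsequence[of M "\<lambda>n. f (s n)"])
    fix q assume "q \<in> M"
    from near[OF this] obtain \<delta> N where "\<delta> > 0" "N \<ge> n0" and N: "\<And>n. n \<ge> N \<Longrightarrow> ball q \<delta> \<subseteq> A n" by metis
    have "(\<forall>z\<in>ball q \<delta>. norm (f (s n) z) \<le> 1) \<and> (\<forall>i. holomorphic_fun_on (\<lambda>z. f (s n) z $ i) (ball q \<delta>))"
      if "n \<ge> N" for n
    proof -
      have sN: "s n \<ge> N" "s n \<ge> n0" using sn[of n] that \<open>N \<ge> n0\<close> by auto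
      then show ?thesis
        using N[OF sN(1)] le1[OF sN(2)] holomorphic_fun_on_subset[OF comp[OF sN(2)] N[OF sN(1)]] by blast
    qed
    then show "\<exists>\<delta>>0. \<exists>N. \<forall>n\<ge>N. (\<forall>z\<in>ball q \<delta>. norm (f (s n) z) \<le> 1) \<and>
        (\<forall>i. holomorphic_fun_on (\<lambda>z. f (s n) z $ i) (ball q \<delta>))"
      using \<open>\<delta> > 0\<close> by blast
  qed (rule that)
  define l where "l = (\<lambda>n. s (k n))"
  have l: "l n \<ge> n" for n
    using sn[of "k n"] seq_suble[OF k, of n] by (simp add: l_def)
  have F': "(\<lambda>n. f (l n) z $ i) \<longlonglongrightarrow> F z i" if "z \<in> M" for z i
    using F[OF that] by (simp add: l_def)
  have limit: "(((\<lambda>z. F z i) has_derivative frechet_derivative (\<lambda>z. F z i) (at q)) (at q) \<and>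
      complex_functional (frechet_derivative (\<lambda>z. F z i) (at q))) \<and>
      (\<forall>v. (\<lambda>n. frechet_derivative (\<lambda>z. f (l n) z $ i) (at q) v) \<longlonglongrightarrow> frechet_derivative (\<lambda>z. F z i) (at q) v)"
    if "q \<in> M" for q i
  proof -
    from near[OF that] obtain \<delta> N where "\<delta> > 0" "N \<ge> n0" and N: "\<And>n. n \<ge> N \<Longrightarrow> ball q \<delta> \<subseteq> A n" by metis
    have lN: "l n \<ge> N" "l n \<ge> n0" if "n \<ge> N" for n using l[of n] that \<open>N \<ge> n0\<close> by auto
    have hol: "holomorphic_fun_on (\<lambda>z. f (l n) z $ i) (ball q \<delta>)" if "n \<ge> N" for n
      using holomorphic_fun_on_subset[OF comp N] lN[OF that] by blast
    have bd: "cmod (f (l n) z $ i) \<le> 1" if "n \<ge> N" "z \<in> ball q \<delta>" for n z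
      using Finite_Cartesian_Product.norm_nth_le[of "f (l n) z" i] le1[of "l n" z] lN[OF that(1)] N[of "l n"] that(2)
      by (meson order_trans subsetD)
    have lim: "(\<lambda>n. f (l n) z $ i) \<longlonglongrightarrow> F z i" if "z \<in> ball q \<delta>" for z
    proof -
      have "z \<in> M" using that N[of N] unfolding M by blast
      then show ?thesis by (rule F')
    qed
    show ?thesis
      using pointwise_limit_derivative[of N "\<lambda>n z. f (l n) z $ i" q \<delta> 1 "\<lambda>z. F z i", OF hol bd lim \<open>\<delta> > 0\<close>]
      by blast
  qed
  have holF: "holomorphic_fun_on (\<lambda>z. F z i) M" for i
    by (rule holomorphic_fun_onI) (use limit in blast)
  define J where "J = (\<lambda>z. det (\<chi> i j. frechet_derivative (\<lambda>z. F z i) (at z) (axis j 1)))"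
  have holJ: "holomorphic_fun_on J M"
    unfolding J_def by (intro holomorphic_fun_on_det holomorphic_fun_on_frechet_derivative holF openM)
  have limJ: "(\<lambda>n. jacobian (f (l n)) z) \<longlonglongrightarrow> J z" if "z \<in> M" for z
    unfolding jacobian_def J_def det_def
    using limit[OF that] by (auto intro!: tendsto_intros)
  have "e \<le> cmod (J p)"
    by (rule Lim_bounded2[OF tendsto_norm[OF limJ[OF p]], of 0]) (use s(2) in \<open>auto simp: l_def\<close>)
  then have Jp: "J p \<noteq> 0" using e(1) by auto
  have F1: "cmod (F z i) \<le> 1" if "z \<in> M" for z i
  proof -
    obtain m where m: "z \<in> A m" using \<open>z \<in> M\<close> M by blast
    show ?thesis
    proof (rule Lim_bounded[OF tendsto_norm[OF F'[OF that]], of "max m n0"], intro allI impI)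
      fix n assume "n \<ge> max m n0"
      then have "l n \<ge> m" "l n \<ge> n0" using l[of n] by auto
      then have "z \<in> A (l n)" using m A(2) by (auto simp: incseq_def)
      then show "norm (f (l n) z $ i) \<le> 1"
        using le1[OF \<open>l n \<ge> n0\<close>] Finite_Cartesian_Product.norm_nth_le order_trans by blast
    qed
  qed
  let ?vol = "emeasure lborel (ball 0 1 :: (complex ^ 'n) set)"
  have intJ: "(\<integral>\<^sup>+z\<in>M. ennreal ((cmod (J z))\<^sup>2) \<partial>lborel) \<le> ?vol"
  proof -
    define w where "w = (\<lambda>n z. ennreal ((cmod (jacobian (f (l (n + n0))) z))\<^sup>2) * indicator (A (l (n + n0))) z)"
    have l0: "l (n + n0) \<ge> n0" for n using l[of "n + n0"] by simp
    have "(\<integral>\<^sup>+z\<in>M. ennreal ((cmod (J z))\<^sup>2) \<partial>lborel) \<le> (\<integral>\<^sup>+z. liminf (\<lambda>n. w n z) \<partial>lborel)"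
    proof (rule nn_integral_mono)
      fix z
      show "ennreal ((cmod (J z))\<^sup>2) * indicator M z \<le> liminf (\<lambda>n. w n z)"
      proof (cases "z \<in> M")
        case True
        then obtain m where m: "z \<in> A m" using M by blast
        have "(\<lambda>n. w n z) \<longlonglongrightarrow> ennreal ((cmod (J z))\<^sup>2)"
        proof (rule Lim_transform_eventually)
          show "(\<lambda>n. ennreal ((cmod (jacobian (f (l (n + n0))) z))\<^sup>2)) \<longlonglongrightarrow> ennreal ((cmod (J z))\<^sup>2)"
            by (intro tendsto_intros tendsto_ennrealI LIMSEQ_ignore_initial_segment limJ True)
          show "\<forall>\<^sub>F n in sequentially. ennreal ((cmod (jacobian (f (l (n + n0))) z))\<^sup>2) = w n z"
            using eventually_ge_at_top[of m]
          proof eventually_elim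
            case (elim n)
            then have "l (n + n0) \<ge> m" using l[of "n + n0"] by simp
            then have "z \<in> A (l (n + n0))" using m A(2) by (auto simp: incseq_def)
            then show ?case by (simp add: w_def)
          qed
        qed
        then have "liminf (\<lambda>n. w n z) = ennreal ((cmod (J z))\<^sup>2)"
          by (intro lim_imp_Liminf) auto
        with True show ?thesis by simp
      qed simp
    qed
    also have "\<dots> \<le> liminf (\<lambda>n. \<integral>\<^sup>+z. w n z \<partial>lborel)"
    proof (rule nn_integral_liminf)
      fix n
      have "continuous_on (A (l (n + n0))) (jacobian (f (l (n + n0))))"
        using l0 by (intro holomorphic_fun_on_imp_continuous_on holomorphic_fun_on_jacobian comp A(1))
      from borel_measurable_cmod_sq_indicator[OF this A(1)]
      have "(\<lambda>z. ennreal ((cmod (indicator (A (l (n + n0))) z *\<^sub>R jacobian (f (l (n + n0))) z))\<^sup>2)) \<in> borel_measurable borel"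
        by measurable
      also have "(\<lambda>z. ennreal ((cmod (indicator (A (l (n + n0))) z *\<^sub>R jacobian (f (l (n + n0))) z))\<^sup>2)) = w n"
        by (auto simp: w_def fun_eq_iff split: split_indicator)
      finally show "w n \<in> borel_measurable lborel" by simp
    qed
    also have "\<dots> \<le> liminf (\<lambda>n. ?vol)"
    proof (rule Liminf_mono, rule always_eventually, rule allI)
      show "(\<integral>\<^sup>+z. w n z \<partial>lborel) \<le> ?vol" for n
        unfolding w_def by (rule nn_integral_jacobian_embedding[OF f(1)[OF l0] A(1) f(2)[OF l0]])
    qed
    also have "\<dots> = ?vol" by (simp add: Liminf_const)
    finally show ?thesis .
  qed
  \<comment> \<open>Any component serves, since the rows of an invertible matrix are nonzero.\<close>
  obtain i :: 'n where True by simp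
  have "\<exists>v. frechet_derivative (\<lambda>z. F z i) (at p) v \<noteq> 0"
  proof (rule ccontr)
    assume "\<not> ?thesis"
    then have "row i (\<chi> i j. frechet_derivative (\<lambda>z. F z i) (at p) (axis j 1)) = 0"
      by (simp add: row_def vec_eq_iff)
    then have "J p = 0" unfolding J_def by (rule det_zero_row)
    with Jp show False by simp
  qed
  then obtain v where v: "frechet_derivative (\<lambda>z. F z i) (at p) v \<noteq> 0" by blast
  define h where "h = (\<lambda>(m::nat) z. if z \<in> M then J z * F z i ^ m else 0)"
  show ?thesis
  proof (rule complex_dimension_infinite)
    show "h m \<in> bergman_space M" for m
    proof -
      have hol: "holomorphic_fun_on (\<lambda>z. J z * F z i ^ m) M"
        by (intro holomorphic_fun_on_mult holomorphic_fun_on_power holJ holF openM)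
      have "holomorphic_fun_on (h m) M"
        unfolding holomorphic_fun_on_def
      proof
        fix z assume z: "z \<in> M"
        with hol obtain L where L: "complex_functional L" "((\<lambda>z. J z * F z i ^ m) has_derivative L) (at z within M)"
          unfolding holomorphic_fun_on_def by blast
        have "(h m has_derivative L) (at z within M)"
          by (rule has_derivative_transform[OF z _ L(2)]) (simp add: h_def)
        with L show "\<exists>L. complex_functional L \<and> (h m has_derivative L) (at z within M)" by blast
      qed
      moreover have "(\<integral>\<^sup>+z\<in>M. ennreal ((cmod (h m z))\<^sup>2) \<partial>lborel) \<le> (\<integral>\<^sup>+z\<in>M. ennreal ((cmod (J z))\<^sup>2) \<partial>lborel)"
      proof (rule nn_integral_mono)
        fix z
        have "(cmod (h m z))\<^sup>2 \<le> (cmod (J z))\<^sup>2" if "z \<in> M"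
        proof (rule power_mono)
          show "cmod (h m z) \<le> cmod (J z)"
            using F1[OF that, of i] that
            by (simp add: h_def norm_mult norm_power mult_left_le power_le_one)
        qed simp
        then show "ennreal ((cmod (h m z))\<^sup>2) * indicator M z \<le> ennreal ((cmod (J z))\<^sup>2) * indicator M z"
          by (auto split: split_indicator intro: ennreal_leI)
      qed
      ultimately show ?thesis
        using intJ emeasure_bounded_finite[of "ball 0 1 :: (complex ^ 'n) set"]
        by (auto simp: bergman_space_def h_def)
    qed
    show "\<forall>k<m. a k = 0" if "\<And>z. (\<Sum>k<m. a k * h k z) = 0" for m a
    proof (rule powers_times_jacobian_independent[OF holJ holF openM p Jp v])
      fix z assume "z \<in> M"
      with that[of z] show "(\<Sum>k<m. a k * (J z * F z i ^ k)) = 0" by (simp add: h_def)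
    qed
  qed
qed

section \<open>Squeezing functions, the Kobayashi metric and the Bergman space\<close>

text \<open>A supremum that is at least \<open>r > 0\<close> is only approached, so half of the radius is given up.  Extracting
an element from the suprema needs them to be genuine: a translated homothety is an admissible embedding
since \<open>U\<close> is bounded, and the image of an admissible embedding contains a ball about \<open>0\<close> since it is open.\<close>

lemma embedding_of_squeezing_bound:
  fixes U :: "(complex ^ 'n) set"
  assumes U: "bounded_domain U" and p: "p \<in> U" and r: "r > 0" "squeezing_function U p \<ge> r"
  shows "\<exists>f :: complex ^ 'n \<Rightarrow> complex ^ 'n. holomorphic_embedding_on f U \<and> f ` U \<subseteq> ball 0 1 \<and> f p = 0 \<and>
    ball 0 (r / 2) \<subseteq> f ` U"
proof -
  have opU: "open U" and bU: "bounded U" using U by (auto simp: bounded_domain_def)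
  define E where "E = {f :: complex ^ 'n \<Rightarrow> complex ^ 'n.
      holomorphic_embedding_on f U \<and> f ` U \<subseteq> ball 0 1 \<and> f p = 0}"
  define R where "R f = {\<rho>. \<rho> > 0 \<and> ball 0 \<rho> \<subseteq> f ` U}" for f :: "complex ^ 'n \<Rightarrow> complex ^ 'n"
  have R1: "\<rho> \<le> 1" if "f \<in> E" "\<rho> \<in> R f" for f \<rho>
  proof -
    have "ball 0 \<rho> \<subseteq> (ball 0 1 :: (complex ^ 'n) set)" "\<rho> > 0"
      using that by (auto simp: E_def R_def)
    then show ?thesis by (simp add: ball_subset_ball_iff)
  qed
  have Rne: "R f \<noteq> {}" if "f \<in> E" for f
  proof -
    have "open (f ` U)"
      using that by (intro holomorphic_embedding_open_image[OF _ opU opU]) (auto simp: E_def)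
    moreover have "0 \<in> f ` U" using that p by (force simp: E_def)
    ultimately obtain e where "e > 0" "ball 0 e \<subseteq> f ` U" by (meson openE)
    then show ?thesis by (auto simp: R_def)
  qed
  have "E \<noteq> {}"
  proof -
    obtain B where B: "\<And>z. z \<in> U \<Longrightarrow> norm z \<le> B" using bU bounded_iff by blast
    define C where "C = \<bar>B\<bar> + norm p + 1"
    have C: "C > 0" "\<And>z. z \<in> U \<Longrightarrow> norm (z - p) < C"
    proof -
      show "C > 0" by (simp add: C_def add_nonneg_pos)
      show "norm (z - p) < C" if "z \<in> U" for z
        using B[OF that] norm_triangle_ineq4[of z p] by (simp add: C_def)
    qed
    define f where "f = (\<lambda>z :: complex ^ 'n. complex_of_real (1 / C) *s (z - p))"
    define L where "L = (\<lambda>z :: complex ^ 'n. complex_of_real (1 / C) *s z)"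
    have L: "complex_linear L"
      unfolding L_def by unfold_locales (auto simp: vec_eq_iff algebra_simps)
    have blL: "bounded_linear L"
      using complex_linear_imp_linear[OF L] by (simp add: linear_conv_bounded_linear)
    have fL: "f = (\<lambda>z. L (z - p))" by (simp add: f_def L_def)
    have "inj L" using C(1) by (auto simp: L_def inj_def vec_eq_iff)
    have der: "(f has_derivative L) (at z within U)" for z
      unfolding fL by (auto intro!: derivative_eq_intros bounded_linear.has_derivative[OF blL])
    let ?g = "\<lambda>w. complex_of_real C *s w + p"
    have "homeomorphism U (f ` U) f ?g"
    proof (rule homeomorphismI)
      show "continuous_on U f"
        unfolding fL by (intro linear_continuous_on_compose[OF _ bounded_linear.linear[OF blL]] continuous_intros)
      have "continuous_on (f ` U) (\<lambda>w. (\<chi> i. complex_of_real C * w $ i) + p)"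
        by (intro continuous_intros)
      then show "continuous_on (f ` U) ?g" by (simp add: vector_scalar_mult_def)
    qed (use C in \<open>auto simp: f_def vec_eq_iff\<close>)
    then have "holomorphic_embedding_on f U"
      unfolding holomorphic_embedding_on_def using L der \<open>inj L\<close> by blast
    moreover have "f ` U \<subseteq> ball 0 1"
    proof clarify
      fix z assume "z \<in> U"
      have "norm (f z) = norm (z - p) / C"
        using C(1) unfolding f_def norm_vector_scalar_mult norm_of_real by simp
      then show "f z \<in> ball 0 1" using C(1) C(2)[OF \<open>z \<in> U\<close>] by simp
    qed
    moreover have "f p = 0" by (simp add: f_def)
    ultimately show ?thesis by (auto simp: E_def)
  qed
  have bdd: "bdd_above ((\<lambda>f. Sup (R f)) ` E)"
    using R1 Rne by (intro bdd_aboveI2[of _ _ 1] cSup_least) auto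
  have "r / 2 < squeezing_function U p" using r by simp
  also have "squeezing_function U p = (SUP f\<in>E. Sup (R f))"
    by (simp add: squeezing_function_def E_def R_def)
  finally obtain f where f: "f \<in> E" "r / 2 < Sup (R f)"
    using less_cSUP_iff[OF \<open>E \<noteq> {}\<close> bdd] by blast
  then obtain \<rho> where "\<rho> \<in> R f" "r / 2 < \<rho>"
    using less_cSupE[OF _ Rne] by metis
  then have "ball 0 (r / 2) \<subseteq> f ` U" by (force simp: R_def)
  with f(1) show ?thesis by (auto simp: E_def)
qed

lemma vec_has_derivative_componentwise:
  fixes \<phi> :: "complex \<Rightarrow> complex ^ 'n"
  assumes "\<And>i. ((\<lambda>t. \<phi> t $ i) has_field_derivative \<xi> $ i) (at t)"
  shows "(\<phi> has_derivative (\<lambda>s. s *s \<xi>)) (at t)"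
proof -
  have "linear (axis i :: complex \<Rightarrow> complex ^ 'n)" for i
    by (rule linearI) (simp_all add: axis_def vec_eq_iff)
  then have bl: "bounded_linear (axis i :: complex \<Rightarrow> complex ^ 'n)" for i
    by (simp add: linear_conv_bounded_linear)
  have sum_axis: "(\<Sum>i\<in>UNIV. axis i (x i)) = (\<chi> i. x i)" for x :: "'n \<Rightarrow> complex"
    by (simp add: vec_eq_iff axis_def if_distrib cong: if_cong)
  have "((\<lambda>t. \<Sum>i\<in>UNIV. axis i (\<phi> t $ i)) has_derivative (\<lambda>s. \<Sum>i\<in>UNIV. axis i (\<xi> $ i * s))) (at t)"
    using assms unfolding has_field_derivative_def
    by (intro has_derivative_sum bounded_linear.has_derivative[OF bl])
  moreover have "(\<chi> i. \<xi> $ i * s) = s *s \<xi>" for s by (simp add: vec_eq_iff)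
  ultimately show ?thesis by (simp add: sum_axis)
qed

text \<open>The set whose infimum is the Kobayashi metric contains \<open>(norm \<xi> + 1) / d\<close> if \<open>ball p d\<close> lies in \<open>M\<close>, by an affine
disc.  It is therefore nonempty, and elements close to the infimum exist.\<close>

lemma kobayashi_metric_zero_discs:
  fixes M :: "(complex ^ 'n) set"
  assumes M: "open M" "p \<in> M" and K: "kobayashi_metric M p \<xi> = 0" and "e > 0"
  obtains s \<phi> where "0 < s" "s < e" "\<And>i. (\<lambda>t. \<phi> t $ i) holomorphic_on ball 0 1"
    "\<phi> ` ball 0 1 \<subseteq> M" "\<phi> 0 = p"
    "\<And>i. ((\<lambda>t. \<phi> t $ i) has_field_derivative \<xi> $ i / of_real s) (at 0)"
proof -
  let ?S = "{s. s > 0 \<and> (\<exists>\<phi> :: complex \<Rightarrow> complex ^ 'n.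
            (\<forall>i. (\<lambda>t. \<phi> t $ i) holomorphic_on ball 0 1) \<and> \<phi> ` ball 0 1 \<subseteq> M \<and> \<phi> 0 = p \<and>
            (\<forall>i. ((\<lambda>t. \<phi> t $ i) has_field_derivative \<xi> $ i / of_real s) (at 0)))}"
  obtain d where d: "d > 0" "ball p d \<subseteq> M" using M openE by blast
  \<comment> \<open>The affine disc through \<open>p\<close> with derivative \<open>\<xi> / s0\<close> stays in \<open>ball p d\<close>.\<close>
  define s0 where "s0 = (norm \<xi> + 1) / d"
  have s0: "s0 > 0" "norm \<xi> / s0 < d"
  proof -
    have "norm \<xi> + 1 > 0" by (simp add: add_nonneg_pos)
    then show "s0 > 0" "norm \<xi> / s0 < d"
      using d by (auto simp: s0_def divide_simps)
  qed
  have "s0 \<in> ?S"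
  proof (intro CollectI conjI exI allI)
    let ?\<phi> = "\<lambda>t. p + t *s ((1 / complex_of_real s0) *s \<xi>)"
    show "(\<lambda>t. ?\<phi> t $ i) holomorphic_on ball 0 1" for i
      using s0(1) by (auto intro!: holomorphic_intros)
    show "((\<lambda>t. ?\<phi> t $ i) has_field_derivative \<xi> $ i / of_real s0) (at 0)" for i
      using s0(1) by (auto intro!: derivative_eq_intros)
    show "?\<phi> ` ball 0 1 \<subseteq> M"
    proof clarify
      fix t :: complex assume "t \<in> ball 0 1"
      then have "cmod t * (norm \<xi> / s0) \<le> norm \<xi> / s0"
        using s0(1) by (intro mult_left_le_one_le) auto
      then have "?\<phi> t \<in> ball p d"
        using s0 by (simp add: dist_norm norm_vector_scalar_mult norm_divide)
      then show "?\<phi> t \<in> M" using d by blast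
    qed
  qed (use s0 in auto)
  then have "?S \<noteq> {}" by blast
  moreover have "Inf ?S < e" using K \<open>e > 0\<close> by (simp add: kobayashi_metric_def)
  ultimately obtain s where "s \<in> ?S" "s < e" by (rule cInf_lessD[THEN bexE])
  then show ?thesis using that by auto
qed

text \<open>A disc through \<open>p\<close> with derivative \<open>\<xi> / s\<close>, shrunk to radius \<open>1 / 2\<close>, lies in \<open>A n\<close> for large \<open>n\<close> by
compactness.  Composed with \<open>f n\<close> it becomes bounded by \<open>1\<close>, so its derivative is at most \<open>4\<close>; this
bounds the components of \<open>L n \<xi>\<close> by \<open>4 s\<close>, and \<open>s\<close> may be taken as small as desired.\<close>

lemma embedding_derivative_tendsto_zero:
  fixes A :: "nat \<Rightarrow> (complex ^ 'n) set"
  assumes A: "\<And>n. open (A n)" "incseq A" and M: "M = (\<Union>n. A n)"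
    and f: "\<And>n. n \<ge> n0 \<Longrightarrow> holomorphic_embedding_on (f n) (A n)" "\<And>n. n \<ge> n0 \<Longrightarrow> f n ` A n \<subseteq> ball 0 1"
    and L: "\<And>n. n \<ge> n0 \<Longrightarrow> (f n has_derivative L n) (at p)" and p: "p \<in> M"
    and K: "kobayashi_metric M p \<xi> = 0"
  shows "(\<lambda>n. L n \<xi> $ i) \<longlonglongrightarrow> 0"
proof (rule LIMSEQ_I)
  fix e :: real assume "e > 0"
  have openM: "open M" using A(1) by (auto simp: M)
  obtain s \<phi> where s: "0 < s" "s < e / 4" and \<phi>: "\<And>i. (\<lambda>t. \<phi> t $ i) holomorphic_on ball 0 1"
    "\<phi> ` ball 0 1 \<subseteq> M" "\<phi> 0 = p"
    "\<And>i. ((\<lambda>t. \<phi> t $ i) has_field_derivative \<xi> $ i / of_real s) (at 0)"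
    using kobayashi_metric_zero_discs[OF openM p K, of "e / 4"] \<open>e > 0\<close> by (metis divide_pos_pos zero_less_numeral)
  have der: "(\<phi> has_derivative (\<lambda>u. u *s (\<chi> i. deriv (\<lambda>t. \<phi> t $ i) t))) (at t)" if "t \<in> ball 0 1" for t
    by (rule vec_has_derivative_componentwise) (use holomorphic_derivI[OF \<phi>(1) open_ball that] in simp)
  have der0: "(\<phi> has_derivative (\<lambda>u. u *s (\<chi> i. \<xi> $ i / of_real s))) (at 0)"
    by (rule vec_has_derivative_componentwise) (use \<phi>(4) in simp)
  have "continuous_on (cball 0 (1/2)) \<phi>"
  proof (intro continuous_at_imp_continuous_on ballI)
    fix t :: complex assume "t \<in> cball 0 (1/2)"
    then have "t \<in> ball 0 1" by simp
    then show "isCont \<phi> t" by (rule has_derivative_continuous[OF der])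
  qed
  then have "compact (\<phi> ` cball 0 (1/2))"
    by (intro compact_continuous_image compact_cball)
  moreover have "\<phi> ` cball 0 (1/2) \<subseteq> \<Union> (range A)"
    using \<phi>(2) M by force
  ultimately obtain D where D: "D \<subseteq> range A" "finite D" "\<phi> ` cball 0 (1/2) \<subseteq> \<Union> D"
    using A(1) compactE[of "\<phi> ` cball 0 (1/2)" "range A"] by (metis imageE)
  obtain I where I: "finite I" "D = A ` I" using D(1,2) finite_subset_image by metis
  obtain m where m: "\<forall>i\<in>I. i \<le> m"
    using I(1) unfolding finite_nat_set_iff_bounded_le by (elim exE)
  have sub: "\<phi> ` ball 0 (1/2) \<subseteq> A n" if "n \<ge> m" for n
  proof -
    have "A i \<subseteq> A n" if "i \<in> I" for i
    proof (rule incseqD[OF A(2)])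
      show "i \<le> n" using m that \<open>n \<ge> m\<close> order_trans by metis
    qed
    then have "\<Union> D \<subseteq> A n" using I(2) by auto
    then show ?thesis using D(3) ball_subset_cball by blast
  qed
  have "norm (L n \<xi> $ i - 0) < e" if n: "n \<ge> max m n0" for n
  proof -
    have fn: "holomorphic_fun_on (\<lambda>z. f n z $ i) (A n)"
      using n by (intro holomorphic_embedding_component f A) auto
    let ?k = "\<lambda>t. f n (\<phi> t) $ i"
    have "?k field_differentiable at t" if t: "t \<in> ball 0 (1/2)" for t
    proof -
      let ?G = "frechet_derivative (\<lambda>z. f n z $ i) (at (\<phi> t))"
      have "\<phi> t \<in> A n" using sub[of n] n t by auto
      note G = holomorphic_fun_onD[OF fn A(1) this]
      have "(?k has_derivative (\<lambda>u. ?G (u *s (\<chi> i. deriv (\<lambda>t. \<phi> t $ i) t)))) (at t)"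
        using t by (intro has_derivative_compose[OF der G(1)]) auto
      then have "(?k has_field_derivative ?G (\<chi> i. deriv (\<lambda>t. \<phi> t $ i) t)) (at t)"
        by (simp add: has_field_derivative_def complex_functional_scale[OF G(2)] mult_commute_abs)
      then show ?thesis unfolding field_differentiable_def by blast
    qed
    then have hol: "?k holomorphic_on ball 0 (1/2)"
      by (meson holomorphic_onI field_differentiable_at_within)
    have "cmod (?k t) \<le> 1" if "t \<in> ball 0 (1/2)" for t
    proof -
      have "\<phi> t \<in> A n" using sub[of n] n that by auto
      then have "f n (\<phi> t) \<in> ball 0 1" using f(2)[of n] n by auto
      then show ?thesis using Finite_Cartesian_Product.norm_nth_le[of "f n (\<phi> t)" i] by simp
    qed
    from Cauchy_estimates_disc(1)[OF hol this] have dk: "cmod (deriv ?k 0) \<le> 4" by simp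
    have Ln: "(f n has_derivative L n) (at (\<phi> 0))" using L[of n] n \<phi>(3) by simp
    have "p \<in> A n" using sub[of n] n \<phi>(3) by (force simp: image_subset_iff)
    then obtain L' where "complex_linear L'" "(f n has_derivative L') (at p)"
      using holomorphic_embedding_derivative[OF f(1) A(1), of n p] n by (metis max.boundedE)
    then have lin: "complex_linear (L n)" using Ln \<phi>(3) has_derivative_unique by metis
    interpret L: Vector_Spaces.linear "(*s)" "(*s)" "L n" by fact
    have "(?k has_derivative (\<lambda>u. L n (u *s (\<chi> i. \<xi> $ i / of_real s)) $ i)) (at 0)"
      using has_derivative_component[OF Ln] by (rule has_derivative_compose[OF der0])
    moreover have "(u *s (\<chi> i. \<xi> $ i / of_real s)) = (u / of_real s) *s \<xi>" for u
      by (simp add: vec_eq_iff)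
    then have "(\<lambda>u. L n (u *s (\<chi> i. \<xi> $ i / of_real s)) $ i) = (*) (L n \<xi> $ i / of_real s)"
      by (simp add: fun_eq_iff L.scale)
    ultimately have "(?k has_field_derivative L n \<xi> $ i / of_real s) (at 0)"
      unfolding has_field_derivative_def by metis
    then have "deriv ?k 0 = L n \<xi> $ i / of_real s" by (rule DERIV_imp_deriv)
    with dk s(1) have "cmod (L n \<xi> $ i) \<le> 4 * s" by (simp add: norm_divide field_simps)
    with s(2) show ?thesis by simp
  qed
  then show "\<exists>no. \<forall>n\<ge>no. norm (L n \<xi> $ i - 0) < e" by blast
qed

lemma det_tendsto:
  fixes X :: "nat \<Rightarrow> complex ^ 'n ^ 'n"
  assumes "X \<longlonglongrightarrow> Y"
  shows "(\<lambda>n. det (X n)) \<longlonglongrightarrow> det Y"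
  unfolding det_def by (intro tendsto_intros assms)

text \<open>Otherwise the derivatives of the \<open>f n\<close> at \<open>p\<close>, which are bounded by the Cauchy estimates, accumulate at
a matrix with nonzero determinant.  That matrix annihilates \<open>\<xi>\<close>, which is impossible.\<close>

lemma jacobian_small_of_kobayashi_zero:
  fixes A :: "nat \<Rightarrow> (complex ^ 'n) set"
  assumes A: "\<And>n. open (A n)" "incseq A" and M: "M = (\<Union>n. A n)"
    and f: "\<And>n. n \<ge> n0 \<Longrightarrow> holomorphic_embedding_on (f n) (A n)" "\<And>n. n \<ge> n0 \<Longrightarrow> f n ` A n \<subseteq> ball 0 1"
    and p: "p \<in> A n0" and K: "kobayashi_metric M p \<xi> = 0" "\<xi> \<noteq> 0" and c: "c > 0"
  shows "\<exists>n\<ge>n0. cmod (jacobian (f n) p) < c"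
proof (rule ccontr)
  assume "\<not> ?thesis"
  then have big: "cmod (jacobian (f n) p) \<ge> c" if "n \<ge> n0" for n using that by force
  have pA: "p \<in> A n" if "n \<ge> n0" for n using p A(2) that by (auto simp: incseq_def)
  then have "\<forall>n\<ge>n0. \<exists>L. complex_linear L \<and> (f n has_derivative L) (at p)"
    using holomorphic_embedding_derivative[OF f(1) A(1)] by metis
  then obtain L where L: "\<And>n. n \<ge> n0 \<Longrightarrow> complex_linear (L n)" "\<And>n. n \<ge> n0 \<Longrightarrow> (f n has_derivative L n) (at p)"
    by metis
  obtain \<delta> where \<delta>: "\<delta> > 0" "ball p \<delta> \<subseteq> A n0" using p A(1) openE by blast
  have entry: "cmod (matrix (L n) $ i $ j) \<le> 2 / \<delta>" if n: "n \<ge> n0" for n i j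
  proof -
    have sub: "ball p \<delta> \<subseteq> A n" using \<delta>(2) A(2) n by (auto simp: incseq_def)
    have "cmod (frechet_derivative (\<lambda>z. f n z $ i) (at p) (axis j 1)) \<le> 2 * 1 / \<delta> * norm (axis j 1 :: complex ^ 'n)"
    proof (rule Cauchy_estimates_ball(1)[OF _ _ \<delta>(1)])
      show "holomorphic_fun_on (\<lambda>z. f n z $ i) (ball p \<delta>)"
        using holomorphic_fun_on_subset[OF holomorphic_embedding_component[OF f(1)[OF n] A(1)] sub] .
      show "cmod (f n z $ i) \<le> 1" if "z \<in> ball p \<delta>" for z
      proof -
        have "f n z \<in> ball 0 1" using f(2)[OF n] sub that by blast
        then show ?thesis using Finite_Cartesian_Product.norm_nth_le[of "f n z" i] by simp
      qed
    qed
    then show ?thesis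
      using frechet_derivative_component[OF L(2)[OF n]] by (simp add: matrix_def norm_Basis axis_in_Basis_iff)
  qed
  define X where "X = (\<lambda>n. matrix (L (n + n0)))"
  have "norm (X n) \<le> real CARD('n) * (real CARD('n) * (2 / \<delta>))" for n
  proof -
    have row: "norm (X n $ i) \<le> real CARD('n) * (2 / \<delta>)" for i
    proof -
      have "norm (X n $ i) \<le> (\<Sum>j\<in>UNIV. cmod (X n $ i $ j))"
        unfolding norm_vec_def[of "X n $ i"] by (rule L2_set_le_sum) simp
      also have "\<dots> \<le> (\<Sum>j\<in>(UNIV :: 'n set). 2 / \<delta>)"
        unfolding X_def by (intro sum_mono entry) simp
      finally show ?thesis by simp
    qed
    have "norm (X n) \<le> (\<Sum>i\<in>UNIV. norm (X n $ i))"
      unfolding norm_vec_def[of "X n"] by (rule L2_set_le_sum) simp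
    also have "\<dots> \<le> (\<Sum>i\<in>(UNIV :: 'n set). real CARD('n) * (2 / \<delta>))"
      by (intro sum_mono row)
    finally show ?thesis by simp
  qed
  then have "bounded (range X)" by (auto simp: bounded_iff)
  then obtain Y r where r: "strict_mono (r :: nat \<Rightarrow> nat)" and Y: "(X \<circ> r) \<longlonglongrightarrow> Y"
    using bounded_imp_convergent_subsequence by blast
  have detX: "det (X n) = jacobian (f (n + n0)) p" for n
    unfolding X_def using jacobian_eq_det[OF L(2)] by simp
  have "c \<le> cmod (det Y)"
    by (rule Lim_bounded2[OF tendsto_norm[OF det_tendsto[OF Y]], of 0]) (use big detX in auto)
  then have "det Y \<noteq> 0" using c by auto
  moreover have "Y *v \<xi> = 0"
  proof -
    have "(Y *v \<xi>) $ i = 0" for i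
    proof (rule LIMSEQ_unique)
      show "(\<lambda>n. (X (r n) *v \<xi>) $ i) \<longlonglongrightarrow> (Y *v \<xi>) $ i"
        unfolding matrix_vector_mult_def using Y by (auto intro!: tendsto_intros simp: comp_def)
      have "p \<in> M" using p M by blast
      have "(\<lambda>n. L n \<xi> $ i) \<longlonglongrightarrow> 0"
        by (rule embedding_derivative_tendsto_zero[OF A M f L(2) \<open>p \<in> M\<close> K(1)])
      then have "(\<lambda>n. L (n + n0) \<xi> $ i) \<longlonglongrightarrow> 0" by (rule LIMSEQ_ignore_initial_segment)
      then have "((\<lambda>n. L (n + n0) \<xi> $ i) \<circ> r) \<longlonglongrightarrow> 0" by (rule LIMSEQ_subseq_LIMSEQ[OF _ r])
      moreover have "X n *v \<xi> = L (n + n0) \<xi>" for n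
        unfolding X_def by (rule matrix_works[OF L(1)]) simp
      ultimately show "(\<lambda>n. (X (r n) *v \<xi>) $ i) \<longlonglongrightarrow> 0" by (simp add: comp_def)
    qed
    then show ?thesis by (simp add: vec_eq_iff)
  qed
  moreover have "\<xi> = 0" if "det Y \<noteq> 0" and Y0: "Y *v \<xi> = 0"
  proof -
    from that(1) obtain Z where "Z ** Y = mat 1"
      unfolding invertible_det_nz[symmetric] invertible_def by blast
    then have "\<xi> = Z *v (Y *v \<xi>)"
      by (simp add: matrix_vector_mul_assoc)
    then show ?thesis
      unfolding Y0 by (simp add: matrix_vector_mult_def vec_eq_iff)
  qed
  ultimately have "\<xi> = 0" by blast
  with K(2) show False by simp
qed


theorem corollary1p10:
  fixes M :: "(complex ^ 'n) set" and Mn :: "nat \<Rightarrow> (complex ^ 'n) set" and r :: real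
  assumes "CARD('n) \<ge> 2"
    and "\<And>n. n \<ge> 1 \<Longrightarrow> bounded_domain (Mn n)"
    and "\<And>n. n \<ge> 1 \<Longrightarrow> relatively_compact_in (Mn n) (Mn (Suc n))"
    and "M = (\<Union>n\<in>{1..}. Mn n)"
    and "r > 0"
    and "\<And>n z. n \<ge> 1 \<Longrightarrow> z \<in> Mn n \<Longrightarrow> squeezing_function (Mn n) z \<ge> r"
  shows "(complex_dimension (bergman_space M) = 0 \<or> complex_dimension (bergman_space M) = \<infinity>) \<and>
    (kobayashi_corank M > 0 \<longrightarrow> emeasure lborel M = \<infinity>)"
proof -
  define A where "A n = Mn (Suc n)" for n
  have bd: "bounded_domain (A n)" for n using assms(2) by (simp add: A_def)
  then have opA: "open (A n)" for n by (simp add: bounded_domain_def)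
  have incA: "incseq A"
  proof (rule incseq_SucI)
    show "A n \<subseteq> A (Suc n)" for n
      using assms(3)[of "Suc n"] closure_subset[of "Mn (Suc n)"] by (auto simp: A_def relatively_compact_in_def)
  qed
  have "{1..} = range Suc" by (auto simp: image_iff Suc_le_eq gr0_conv_Suc)
  then have M: "M = (\<Union>n. A n)" by (simp add: assms(4) A_def)
  have openM: "open M" using opA by (auto simp: M)
  have neM: "M \<noteq> {}" using bd[of 0] by (auto simp: M bounded_domain_def)
  let ?B = "ball 0 (r / 2) :: (complex ^ 'n) set"
  have vol: "emeasure lborel ?B > 0"
    using content_ball_pos[of "r / 2" "0 :: complex ^ 'n"] assms(5) emeasure_bounded_finite[of ?B]
    by (simp add: emeasure_eq_ennreal_measure)
  have emb: "\<exists>f n0. p \<in> A n0 \<and> (\<forall>n\<ge>n0. holomorphic_embedding_on (f n) (A n) \<and> f n ` A n \<subseteq> ball 0 1 \<and>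
      f n p = 0 \<and> ?B \<subseteq> f n ` A n)" if p: "p \<in> M" for p
  proof -
    obtain n0 where n0: "p \<in> A n0" using p M by blast
    have "\<exists>f :: complex ^ 'n \<Rightarrow> complex ^ 'n. holomorphic_embedding_on f (A n) \<and> f ` A n \<subseteq> ball 0 1 \<and> f p = 0 \<and>
        ?B \<subseteq> f ` A n" if "n \<ge> n0" for n
    proof -
      have "p \<in> A n" using n0 incA that by (auto simp: incseq_def)
      then show ?thesis
        using embedding_of_squeezing_bound[of "A n" p r] bd[of n] assms(5) assms(6)[of "Suc n" p]
        by (simp add: A_def)
    qed
    with n0 show ?thesis by metis
  qed
  have point: "ennreal ((cmod (F p))\<^sup>2) * emeasure lborel ?B \<le>
      ennreal ((cmod (jacobian f p))\<^sup>2) * (\<integral>\<^sup>+z\<in>M. ennreal ((cmod (F z))\<^sup>2) \<partial>lborel)"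
    if F: "F \<in> bergman_space M" and p: "p \<in> A n"
      and f: "holomorphic_embedding_on f (A n)" "f p = 0" "?B \<subseteq> f ` A n" for F p f n
  proof -
    have "A n \<subseteq> M" using M by blast
    then have hol: "holomorphic_fun_on F (A n)"
      using F holomorphic_fun_on_subset by (auto simp: bergman_space_def)
    have le: "(\<integral>\<^sup>+z\<in>A n. ennreal ((cmod (F z))\<^sup>2) \<partial>lborel) \<le> (\<integral>\<^sup>+z\<in>M. ennreal ((cmod (F z))\<^sup>2) \<partial>lborel)"
      using \<open>A n \<subseteq> M\<close> by (intro nn_integral_mono) (auto split: split_indicator)
    have fin: "(\<integral>\<^sup>+z\<in>M. ennreal ((cmod (F z))\<^sup>2) \<partial>lborel) < \<infinity>"
      using F by (simp add: bergman_space_def)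
    have "ennreal ((cmod (F p))\<^sup>2) * emeasure lborel ?B \<le>
        ennreal ((cmod (jacobian f p))\<^sup>2) * (\<integral>\<^sup>+z\<in>A n. ennreal ((cmod (F z))\<^sup>2) \<partial>lborel)"
      using assms(5) le_less_trans[OF le fin] by (intro point_estimate_by_embedding f opA p hol) auto
    also have "\<dots> \<le> ennreal ((cmod (jacobian f p))\<^sup>2) * (\<integral>\<^sup>+z\<in>M. ennreal ((cmod (F z))\<^sup>2) \<partial>lborel)"
      by (rule mult_left_mono[OF le]) simp
    finally show ?thesis .
  qed
  \<comment> \<open>If embeddings of arbitrarily small Jacobian exist at \<open>p\<close>, the whole Bergman space vanishes there.\<close>
  have vanish: "F p = 0"
    if F: "F \<in> bergman_space M" and p: "p \<in> A n0"
      and f: "\<And>n. n \<ge> n0 \<Longrightarrow> holomorphic_embedding_on (f n) (A n) \<and> f n p = 0 \<and> ?B \<subseteq> f n ` A n"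
      and small: "\<And>c. c > 0 \<Longrightarrow> \<exists>n\<ge>n0. cmod (jacobian (f n) p) < c" for F p f n0
  proof (rule ccontr)
    assume "F p \<noteq> 0"
    let ?I = "\<integral>\<^sup>+z\<in>M. ennreal ((cmod (F z))\<^sup>2) \<partial>lborel"
    have "?I < \<infinity>" using F by (simp add: bergman_space_def)
    then obtain I where I: "?I = ennreal I" "I \<ge> 0" by (cases ?I) auto
    obtain b where b: "emeasure lborel ?B = ennreal b" "b > 0"
      using vol emeasure_bounded_finite[of ?B] by (cases "emeasure lborel ?B") auto
    \<comment> \<open>For \<open>\<bar>J\<bar> < c\<close> the point estimate fails strictly; \<open>I + 1\<close> avoids a zero denominator.\<close>
    define c where "c = sqrt ((cmod (F p))\<^sup>2 * b / (I + 1))"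
    have pos: "(cmod (F p))\<^sup>2 * b > 0" using \<open>F p \<noteq> 0\<close> b(2) by simp
    then have "c > 0" using I(2) by (simp add: c_def)
    then obtain n where n: "n \<ge> n0" "cmod (jacobian (f n) p) < c" using small by blast
    have "p \<in> A n" using p incA n(1) by (auto simp: incseq_def)
    from point[OF F this] f[OF n(1)]
    have "(cmod (F p))\<^sup>2 * b \<le> (cmod (jacobian (f n) p))\<^sup>2 * I"
      using b(2) I by (simp add: I(1) b(1) flip: ennreal_mult')
    also have "\<dots> \<le> c\<^sup>2 * I"
      using n(2) I(2) by (intro mult_right_mono power_mono) auto
    also have "\<dots> = (cmod (F p))\<^sup>2 * b * (I / (I + 1))"
      using pos I(2) by (simp add: c_def)
    also have "\<dots> < (cmod (F p))\<^sup>2 * b * 1"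
      using pos I(2) by (intro mult_strict_left_mono) auto
    finally show False by simp
  qed
  have "complex_dimension (bergman_space M) = 0 \<or> complex_dimension (bergman_space M) = \<infinity>"
  proof (cases "\<exists>p F. p \<in> M \<and> F \<in> bergman_space M \<and> F p \<noteq> 0")
    case True
    then obtain p F where pF: "p \<in> M" "F \<in> bergman_space M" "F p \<noteq> 0" by blast
    obtain f n0 where f: "p \<in> A n0" "\<And>n. n \<ge> n0 \<Longrightarrow> holomorphic_embedding_on (f n) (A n) \<and> f n ` A n \<subseteq> ball 0 1 \<and>
      f n p = 0 \<and> ?B \<subseteq> f n ` A n" using emb[OF pF(1)] by metis
    have "\<not> (\<lambda>n. jacobian (f n) p) \<longlonglongrightarrow> 0"
    proof
      assume lim: "(\<lambda>n. jacobian (f n) p) \<longlonglongrightarrow> 0"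
      have "\<exists>n\<ge>n0. cmod (jacobian (f n) p) < c" if "c > 0" for c
        using LIMSEQ_D[OF lim that] by (metis diff_zero max.cobounded1 max.cobounded2)
      with vanish[OF pF(2) f(1)] f(2) pF(3) show False by blast
    qed
    then show ?thesis
      using bergman_space_infinite_dimensional[OF opA incA M _ _ pF(1)] f(2) by metis
  next
    case False
    moreover have "F z = 0" if "F \<in> bergman_space M" "z \<notin> M" for F z
      using that by (simp add: bergman_space_def)
    ultimately have "F z = 0" if "F \<in> bergman_space M" for F z
      using that by blast
    then have "bergman_space M \<subseteq> {0}"
      by (auto simp: fun_eq_iff)
    then have "cfun.dim (bergman_space M) = 0"
      using cfun.dim_le_card[of "bergman_space M" "{}"] by auto
    moreover have "bergman_space M \<subseteq> cfun.span {}"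
      using \<open>bergman_space M \<subseteq> {0}\<close> by simp
    ultimately show ?thesis
      by (auto simp: complex_dimension_def zero_enat_def)
  qed
  moreover have "emeasure lborel M = \<infinity>" if corank: "kobayashi_corank M > 0"
  proof (rule ccontr)
    assume "emeasure lborel M \<noteq> \<infinity>"
    then have fin: "emeasure lborel M < \<infinity>" by (simp add: top.not_eq_extremum)
    define p where "p = (SOME p. p \<in> M)"
    have p: "p \<in> M" unfolding p_def using neM by (simp add: some_in_eq)
    have "vec.dim {\<xi>. kobayashi_metric M p \<xi> = 0} > 0"
      using corank by (simp add: kobayashi_corank_def kobayashi_corank_at_def p_def)
    then obtain \<xi> where \<xi>: "kobayashi_metric M p \<xi> = 0" "\<xi> \<noteq> 0"
      by (metis (mono_tags, lifting) less_numeral_extra(3) mem_Collect_eq singletonI subsetI vec.dim_eq_0)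
    obtain f n0 where f: "p \<in> A n0" "\<And>n. n \<ge> n0 \<Longrightarrow> holomorphic_embedding_on (f n) (A n) \<and> f n ` A n \<subseteq> ball 0 1 \<and>
      f n p = 0 \<and> ?B \<subseteq> f n ` A n" using emb[OF p] by metis
    have small: "\<exists>n\<ge>n0. cmod (jacobian (f n) p) < c" if "c > 0" for c
      using f(2) by (intro jacobian_small_of_kobayashi_zero[OF opA incA M _ _ f(1) \<xi> that]) auto
    let ?F = "\<lambda>z. if z \<in> M then 1 else 0 :: complex"
    have "?F \<in> bergman_space M"
    proof -
      have "holomorphic_fun_on ?F M"
        unfolding holomorphic_fun_on_def
      proof
        fix z assume z: "z \<in> M"
        have "complex_functional (\<lambda>_ :: complex ^ 'n. 0)" by (rule complex_functionalI) auto
        moreover have "(?F has_derivative (\<lambda>_. 0)) (at z within M)"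
          by (rule has_derivative_transform[OF z _ has_derivative_const[of 1]]) simp
        ultimately show "\<exists>L. complex_functional L \<and> (?F has_derivative L) (at z within M)" by blast
      qed
      moreover have "(\<integral>\<^sup>+z\<in>M. ennreal ((cmod (?F z))\<^sup>2) \<partial>lborel) = (\<integral>\<^sup>+z. indicator M z \<partial>lborel)"
        by (intro nn_integral_cong) (auto split: split_indicator)
      ultimately show ?thesis
        using fin openM by (simp add: bergman_space_def)
    qed
    from vanish[OF this f(1) _ small] f(2) have "?F p = 0" by blast
    with p show False by simp
  qed
  ultimately show ?thesis by blast
qed

end
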